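(* Consider the $T$-period setting described in the context. Assume: (Irreversible treatment) For all $t\in\mathcal{T}\setminus\{T\}$, $D_{i,t}=1\implies D_{i,t+1}=1$. (Exclusion) For each $t\in\mathcal{T}$ and $z\in\{0,1\}$, $Y_{i,t}(0,z)=Y_{i,t}(0)$ and $Y_{i,t}(1,\tau,z)=Y_{i,t}(1,\tau)$ for all $\tau\in\{0,\dots,t-1\}$ (that is, potential outcomes do not depend on $z$). (Independence) For all $t\in\mathcal{T}$, $\big(Y_{i,t}(0),Y_{i,t}(1,0),\dots,Y_{i,t}(1,t-1),D_{i,1}(1),D_{i,1}(0),\dots,D_{i,t}(1),D_{i,t}(0)\big)$ is independent of $Z_i$. (Relevance at $t=1$) $FS_1\neq 0$. (Monotonicity at $t=1$) $\mathbb{P}(F_1)=0$. Then, for any $t\in\mathcal{T}\setminus\{1\}$ such that $FS_t\neq 0$, $RF_t/FS_t$ is a linear combination of the causal effects $\Delta_t^{t-1}(C_1)$ (with weight $\mathbb{P}(C_1)/FS_t$), $\Delta_t^{t-k}(g)$ for $g\in\mathcal{G}^-_k$, $k=2,\dots,t$ (with weight $-\mathbb{P}(g)/FS_t$), and $\Delta_t^{t-k}(g)$ for $g\in\mathcal{G}^+_k$, $k=2,\dots,t$ (with weight $\mathbb{P}(g)/FS_t$), in which the weights sum to one but some of them may be negative (the assumptions do not guarantee that they are all nonnegative). A sufficient condition for the existence of negative weights at $t$ is the existence of $k\in\{2,\dots,t\}$ such that $FS_k<FS_{k-1}$. Moreover, the causal effects that are negatively weighted in $RF_t/FS_t$ are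 the same as those that are negatively weighted in $RF_t$ (where the respective weights are $\mathbb{P}(C_1)$, $-\mathbb{P}(g)$ for $g\in\mathcal{G}^-_k$, and $\mathbb{P}(g)$ for $g\in\mathcal{G}^+_k$) if, and only if, $FS_t>0$.
   Context: Setting. Time is $t\in\mathcal{T}=\{1,\dots,T\}$; $i$ denotes a generic observation. $Z_i\in\{0,1\}$ is a time-invariant binary instrument with $0<\mathbb{P}(Z_i=1)<1$. $D_{i,t}(z)\in\{0,1\}$ is the potential treatment status at $t$ under instrument value $z$, and the observed status is $D_{i,t}=D_{i,t}(Z_i)$. No unit is treated before period 1. $Y_{i,t}(0,z)$ is the potential outcome at $t$ if $i$ has not been treated up to $t$ and the instrument is $z$; $Y_{i,t}(1,\tau,z)$, $\tau\in\{0,\dots,t-1\}$, is the potential outcome at $t$ if $i$ is first treated at period $t-\tau$ and the instrument is $z$. The observed outcome $Y_{i,t}$ equals $Y_{i,t}(0,Z_i)$ if $i$ has not been treated up to $t$, and $Y_{i,t}(1,t-s,Z_i)$ if $i$ was first treated at $s\le t$. All expectations written are assumed to exist (one may take all potential outcomes to be integrable). Latent types at $t$ (events): $AT_t=\{D_{i,t}(1)=D_{i,t}(0)=1\}$, $C_t=\{D_{i,t}(1)>D_{i,t}(0)\}$, $F_t=\{D_{i,t}(1)<D_{i,t}(0)\}$, $NT_t=\{D_{i,t}(1)=D_{i,t}(0)=0\}$. $C_{t:t'}$ means complier in every period from $t$ to $t'$ ($\bigcap_{s=t}^{t'}C_s$), similarly $F_{t:t'}$, $NT_{t:t'}$; a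 tuple denotes the intersection of its entries. Sets of latent groups: $\mathcal{G}^+_2=\{(NT_1,C_2)\}$, $\mathcal{G}^-_2=\{(C_1,AT_2),(NT_1,F_2)\}$, and for $t\in\mathcal{T}\setminus\{1,2\}$, $$\mathcal{G}^+_t=\{(NT_{1:t-1},C_t),\ (NT_{1:\ell-1},F_{\ell:t-1},AT_t):\ell=2,\dots,t-1\},$$ $$\mathcal{G}^-_t=\{(C_{1:t-1},AT_t),\ (NT_{1:t-1},F_t),\ (NT_{1:\ell-1},C_{\ell:t-1},AT_t):\ell=2,\dots,t-1\}.$$ Estimands: $RF_t=\mathbb{E}[Y_{i,t}\mid Z_i=1]-\mathbb{E}[Y_{i,t}\mid Z_i=0]$ and $FS_t=\mathbb{E}[D_{i,t}\mid Z_i=1]-\mathbb{E}[D_{i,t}\mid Z_i=0]$. Causal effects (under exclusion): for a latent group $g$, $\Delta_t^\tau(g)=\mathbb{E}[Y_{i,t}(1,\tau)-Y_{i,t}(0)\mid g]$. A product of $\Delta_t^\tau(g)$ with a weight that is zero because $\mathbb{P}(g)=0$ is read as $0$. *)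

theory Defs
  imports "HOL-Probability.Probability"
begin

text \<open>
  Binary variables (instrument, treatment status) are Boolean-valued, with \<open>True\<close> for 1 and
  \<open>False\<close> for 0.  The primitives of the model, on a probability space \<open>M\<close>, are
    \<^item> \<open>Z \<omega>\<close>, the time-invariant instrument;
    \<^item> \<open>D t z \<omega>\<close>, the potential treatment status at \<open>t\<close> under instrument value \<open>z\<close>;
    \<^item> \<open>Y0z t z \<omega>\<close>, the potential outcome at \<open>t\<close> if untreated up to \<open>t\<close>, under \<open>z\<close>;
    \<^item> \<open>Y1z t \<tau> z \<omega>\<close>, the potential outcome at \<open>t\<close> if first treated at \<open>t - \<tau>\<close>, under \<open>z\<close>.
  Under exclusion, \<open>Y0 t \<omega>\<close> and \<open>Y1 t \<tau> \<omega>\<close> are the potential outcomes without the argument \<open>z\<close>.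
\<close>

locale iv_setting = prob_space M for M :: "'a measure" +
  fixes T :: nat
    and Z :: "'a \<Rightarrow> bool"
    and D :: "nat \<Rightarrow> bool \<Rightarrow> 'a \<Rightarrow> bool"
    and Y0z :: "nat \<Rightarrow> bool \<Rightarrow> 'a \<Rightarrow> real"
    and Y1z :: "nat \<Rightarrow> nat \<Rightarrow> bool \<Rightarrow> 'a \<Rightarrow> real"
  assumes Z_measurable: "Z \<in> measurable M (count_space UNIV)"
    and Z_nondegenerate: "0 < measure M {\<omega> \<in> space M. Z \<omega>}" "measure M {\<omega> \<in> space M. Z \<omega>} < 1"
    and D_measurable: "\<And>t z. t \<in> {1..T} \<Longrightarrow> D t z \<in> measurable M (count_space UNIV)"
    and Y0z_integrable: "\<And>t z. t \<in> {1..T} \<Longrightarrow> integrable M (Y0z t z)"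
    and Y1z_integrable: "\<And>t \<tau> z. t \<in> {1..T} \<Longrightarrow> \<tau> \<in> {0..t - 1} \<Longrightarrow> integrable M (Y1z t \<tau> z)"

definition observed_treatment ::
  "('a \<Rightarrow> bool) \<Rightarrow> (nat \<Rightarrow> bool \<Rightarrow> 'a \<Rightarrow> bool) \<Rightarrow> nat \<Rightarrow> 'a \<Rightarrow> bool" where
  "observed_treatment Z D t \<omega> = D t (Z \<omega>) \<omega>"

definition observed_outcome ::
  "('a \<Rightarrow> bool) \<Rightarrow> (nat \<Rightarrow> bool \<Rightarrow> 'a \<Rightarrow> bool) \<Rightarrow> (nat \<Rightarrow> bool \<Rightarrow> 'a \<Rightarrow> real)
    \<Rightarrow> (nat \<Rightarrow> nat \<Rightarrow> bool \<Rightarrow> 'a \<Rightarrow> real) \<Rightarrow> nat \<Rightarrow> 'a \<Rightarrow> real" where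
  "observed_outcome Z D Y0z Y1z t \<omega> =
    (if \<exists>s\<in>{1..t}. observed_treatment Z D s \<omega>
     then Y1z t (t - (LEAST s. s \<in> {1..t} \<and> observed_treatment Z D s \<omega>)) (Z \<omega>) \<omega>
     else Y0z t (Z \<omega>) \<omega>)"

text \<open>Equalities and implications between random variables are understood almost surely.\<close>

definition irreversible_treatment ::
  "'a measure \<Rightarrow> nat \<Rightarrow> ('a \<Rightarrow> bool) \<Rightarrow> (nat \<Rightarrow> bool \<Rightarrow> 'a \<Rightarrow> bool) \<Rightarrow> bool" where
  "irreversible_treatment M T Z D \<longleftrightarrow>
    (\<forall>t \<in> {1..T} - {T}. AE \<omega> in M. observed_treatment Z D t \<omega> \<longrightarrow> observed_treatment Z D (t + 1) \<omega>)"

definition exclusion ::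
  "'a measure \<Rightarrow> nat \<Rightarrow> (nat \<Rightarrow> bool \<Rightarrow> 'a \<Rightarrow> real) \<Rightarrow> (nat \<Rightarrow> nat \<Rightarrow> bool \<Rightarrow> 'a \<Rightarrow> real)
    \<Rightarrow> (nat \<Rightarrow> 'a \<Rightarrow> real) \<Rightarrow> (nat \<Rightarrow> nat \<Rightarrow> 'a \<Rightarrow> real) \<Rightarrow> bool" where
  "exclusion M T Y0z Y1z Y0 Y1 \<longleftrightarrow>
    (\<forall>t \<in> {1..T}. \<forall>z.
      (AE \<omega> in M. Y0z t z \<omega> = Y0 t \<omega>) \<and>
      (\<forall>\<tau> \<in> {0..t - 1}. AE \<omega> in M. Y1z t \<tau> z \<omega> = Y1 t \<tau> \<omega>))"

text \<open>
  Independence of two random variables with values in different types; the library's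
  \<open>indep_var\<close> forces both variables to have the same value type.
\<close>

definition indep_rv :: "'a measure \<Rightarrow> 'b measure \<Rightarrow> ('a \<Rightarrow> 'b) \<Rightarrow> 'c measure \<Rightarrow> ('a \<Rightarrow> 'c) \<Rightarrow> bool" where
  "indep_rv M A X B W \<longleftrightarrow>
    X \<in> measurable M A \<and> W \<in> measurable M B \<and>
    prob_space.indep_set M {X -` S \<inter> space M | S. S \<in> sets A} {W -` S \<inter> space M | S. S \<in> sets B}"

definition independence ::
  "'a measure \<Rightarrow> nat \<Rightarrow> ('a \<Rightarrow> bool) \<Rightarrow> (nat \<Rightarrow> bool \<Rightarrow> 'a \<Rightarrow> bool)
    \<Rightarrow> (nat \<Rightarrow> 'a \<Rightarrow> real) \<Rightarrow> (nat \<Rightarrow> nat \<Rightarrow> 'a \<Rightarrow> real) \<Rightarrow> bool" where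
  "independence M T Z D Y0 Y1 \<longleftrightarrow>
    (\<forall>t \<in> {1..T}.
      indep_rv M
        (borel \<Otimes>\<^sub>M (\<Pi>\<^sub>M \<tau>\<in>{0..t - 1}. borel) \<Otimes>\<^sub>M (\<Pi>\<^sub>M p\<in>{1..t} \<times> UNIV. count_space UNIV))
        (\<lambda>\<omega>. (Y0 t \<omega>, (\<lambda>\<tau>\<in>{0..t - 1}. Y1 t \<tau> \<omega>), (\<lambda>(s, z)\<in>{1..t} \<times> UNIV. D s z \<omega>)))
        (count_space UNIV) Z)"

definition cexp :: "'a measure \<Rightarrow> ('a \<Rightarrow> real) \<Rightarrow> 'a set \<Rightarrow> real" where
  "cexp M X A = (LINT \<omega>:A|M. X \<omega>) / measure M A"

definition RF ::
  "'a measure \<Rightarrow> ('a \<Rightarrow> bool) \<Rightarrow> (nat \<Rightarrow> bool \<Rightarrow> 'a \<Rightarrow> bool) \<Rightarrow> (nat \<Rightarrow> bool \<Rightarrow> 'a \<Rightarrow> real)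
    \<Rightarrow> (nat \<Rightarrow> nat \<Rightarrow> bool \<Rightarrow> 'a \<Rightarrow> real) \<Rightarrow> nat \<Rightarrow> real" where
  "RF M Z D Y0z Y1z t =
    cexp M (observed_outcome Z D Y0z Y1z t) {\<omega> \<in> space M. Z \<omega>} -
    cexp M (observed_outcome Z D Y0z Y1z t) {\<omega> \<in> space M. \<not> Z \<omega>}"

definition FS :: "'a measure \<Rightarrow> ('a \<Rightarrow> bool) \<Rightarrow> (nat \<Rightarrow> bool \<Rightarrow> 'a \<Rightarrow> bool) \<Rightarrow> nat \<Rightarrow> real" where
  "FS M Z D t =
    cexp M (\<lambda>\<omega>. of_bool (observed_treatment Z D t \<omega>)) {\<omega> \<in> space M. Z \<omega>} -
    cexp M (\<lambda>\<omega>. of_bool (observed_treatment Z D t \<omega>)) {\<omega> \<in> space M. \<not> Z \<omega>}"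

datatype latent_type = AT | C | F | NT

fun type_event ::
  "'a measure \<Rightarrow> (nat \<Rightarrow> bool \<Rightarrow> 'a \<Rightarrow> bool) \<Rightarrow> nat \<Rightarrow> latent_type \<Rightarrow> 'a set" where
  "type_event M D t AT = {\<omega> \<in> space M. D t True \<omega> \<and> D t False \<omega>}"
| "type_event M D t C = {\<omega> \<in> space M. D t True \<omega> \<and> \<not> D t False \<omega>}"
| "type_event M D t F = {\<omega> \<in> space M. \<not> D t True \<omega> \<and> D t False \<omega>}"
| "type_event M D t NT = {\<omega> \<in> space M. \<not> D t True \<omega> \<and> \<not> D t False \<omega>}"

text \<open>
  All latent groups prescribe the type in every period from 1 up to some period \<open>k\<close>.  A group is
  therefore the list of its types, whose length is \<open>k\<close> and whose \<open>j\<close>-th entry (counted from 0) is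
  the type in period \<open>j + 1\<close>; for instance NT in periods 1 to \<open>k - 1\<close> and C in
  period \<open>k\<close> is \<open>replicate (k - 1) NT @ [C]\<close>.
\<close>

type_synonym latent_group = "latent_type list"

definition group_event ::
  "'a measure \<Rightarrow> (nat \<Rightarrow> bool \<Rightarrow> 'a \<Rightarrow> bool) \<Rightarrow> latent_group \<Rightarrow> 'a set" where
  "group_event M D g = {\<omega> \<in> space M. \<forall>j < length g. \<omega> \<in> type_event M D (j + 1) (g ! j)}"

definition group_prob ::
  "'a measure \<Rightarrow> (nat \<Rightarrow> bool \<Rightarrow> 'a \<Rightarrow> bool) \<Rightarrow> latent_group \<Rightarrow> real" where
  "group_prob M D g = measure M (group_event M D g)"

text \<open>For \<open>k = 2\<close> the range of \<open>l\<close> is empty, which gives the separately listed sets at period 2.\<close>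

definition Gplus :: "nat \<Rightarrow> latent_group set" where
  "Gplus k = {replicate (k - 1) NT @ [C]} \<union>
    {replicate (l - 1) NT @ replicate (k - l) F @ [AT] | l. l \<in> {2..k - 1}}"

definition Gminus :: "nat \<Rightarrow> latent_group set" where
  "Gminus k = {replicate (k - 1) C @ [AT], replicate (k - 1) NT @ [F]} \<union>
    {replicate (l - 1) NT @ replicate (k - l) C @ [AT] | l. l \<in> {2..k - 1}}"

definition causal_effect ::
  "'a measure \<Rightarrow> (nat \<Rightarrow> bool \<Rightarrow> 'a \<Rightarrow> bool) \<Rightarrow> (nat \<Rightarrow> 'a \<Rightarrow> real) \<Rightarrow> (nat \<Rightarrow> nat \<Rightarrow> 'a \<Rightarrow> real)
    \<Rightarrow> nat \<Rightarrow> nat \<Rightarrow> latent_group \<Rightarrow> real" where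
  "causal_effect M D Y0 Y1 t \<tau> g = cexp M (\<lambda>\<omega>. Y1 t \<tau> \<omega> - Y0 t \<omega>) (group_event M D g)"

text \<open>
  The groups whose effects enter at \<open>t\<close>.  The groups for period \<open>k\<close> have length \<open>k\<close>, so \<open>g\<close>
  determines both its sign and the superscript \<open>t - k\<close> of its effect: the causal effects in the
  decomposition at \<open>t\<close> are identified by their group.
\<close>

definition effect_groups :: "nat \<Rightarrow> latent_group set" where
  "effect_groups t = {[C]} \<union> (\<Union>k\<in>{2..t}. Gminus k \<union> Gplus k)"

definition RF_weight ::
  "'a measure \<Rightarrow> (nat \<Rightarrow> bool \<Rightarrow> 'a \<Rightarrow> bool) \<Rightarrow> nat \<Rightarrow> latent_group \<Rightarrow> real" where
  "RF_weight M D t g =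
    (if g \<in> (\<Union>k\<in>{2..t}. Gminus k) then - group_prob M D g else group_prob M D g)"

definition ratio_weight ::
  "'a measure \<Rightarrow> ('a \<Rightarrow> bool) \<Rightarrow> (nat \<Rightarrow> bool \<Rightarrow> 'a \<Rightarrow> bool) \<Rightarrow> nat \<Rightarrow> latent_group \<Rightarrow> real" where
  "ratio_weight M Z D t g = RF_weight M D t g / FS M Z D t"

definition iv_assumptions ::
  "'a measure \<Rightarrow> nat \<Rightarrow> ('a \<Rightarrow> bool) \<Rightarrow> (nat \<Rightarrow> bool \<Rightarrow> 'a \<Rightarrow> bool) \<Rightarrow> (nat \<Rightarrow> bool \<Rightarrow> 'a \<Rightarrow> real)
    \<Rightarrow> (nat \<Rightarrow> nat \<Rightarrow> bool \<Rightarrow> 'a \<Rightarrow> real) \<Rightarrow> (nat \<Rightarrow> 'a \<Rightarrow> real) \<Rightarrow> (nat \<Rightarrow> nat \<Rightarrow> 'a \<Rightarrow> real) \<Rightarrow> bool" where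
  "iv_assumptions M T Z D Y0z Y1z Y0 Y1 \<longleftrightarrow>
    iv_setting M T Z D Y0z Y1z \<and>
    irreversible_treatment M T Z D \<and>
    exclusion M T Y0z Y1z Y0 Y1 \<and>
    independence M T Z D Y0 Y1 \<and>
    FS M Z D 1 \<noteq> 0 \<and>
    measure M (type_event M D 1 F) = 0"

end

theory Submission
  imports Defs
begin

text \<open>
  Let \<open>A(z)\<close> be the first treatment period under instrument value \<open>z\<close>.  Exclusion and independence
  turn \<open>RF\<^sub>t\<close> into the sum over \<open>k \<le> t\<close> of the expectations of
  \<open>(1{A(1) = k} - 1{A(0) = k}) (Y\<^sub>t(1, t - k) - Y\<^sub>t(0))\<close>, and \<open>FS\<^sub>t\<close> into the same sum with the
  outcome contrast replaced by 1.  Along irreversible paths without defiers in period 1, the types up to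
  \<open>k\<close> determine the bracket: it is 1 exactly on the groups of \<open>G\<^sup>+\<^sub>k\<close> and -1 exactly on those of
  \<open>G\<^sup>-\<^sub>k\<close> (on \<open>C\<^sub>1\<close>, with sign +, for \<open>k = 1\<close>).  Hence \<open>FS\<^sub>k - FS\<^sub>k\<^sub>-\<^sub>1\<close> is the signed mass of the
  period-\<open>k\<close> groups, so a decrease forces mass on \<open>G\<^sup>-\<^sub>k\<close>.  If \<open>FS\<^sub>t < 0\<close>, dividing by it makes
  the weight of \<open>C\<^sub>1\<close> negative, because \<open>P(C\<^sub>1) = FS\<^sub>1 > 0\<close>.
\<close>

section \<open>Independence of variables with different value types\<close>

lemma Int_stable_vimage_sets: "Int_stable {X -` S \<inter> \<Omega> | S. S \<in> sets N}"
proof (rule Int_stableI, clarsimp)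
  fix S S' assume "S \<in> sets N" "S' \<in> sets N"
  then show "\<exists>U. X -` S \<inter> \<Omega> \<inter> (X -` S' \<inter> \<Omega>) = X -` U \<inter> \<Omega> \<and> U \<in> sets N"
    by (intro exI[of _ "S \<inter> S'"]) auto
qed

lemma (in prob_space) indep_set_mono:
  assumes "indep_set A B" "A' \<subseteq> A" "B' \<subseteq> B"
  shows "indep_set A' B'"
  using assms unfolding indep_sets2_eq by blast

text \<open>Preimages under the composites are among the preimages under \<open>X\<close> and
  \<open>W\<close>, so the independent families only shrink. Once \<open>f\<close> and
  \<open>g\<close> map into a common value type, \<open>indep_var\<close> and its product rule for
  integrals apply.\<close>

lemma (in prob_space) indep_var_compose_rv:
  assumes indep: "indep_rv M A X B W"
    and f: "f \<in> measurable A N" and g: "g \<in> measurable B N'"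
  shows "indep_var N (\<lambda>\<omega>. f (X \<omega>)) N' (\<lambda>\<omega>. g (W \<omega>))"
proof -
  have X: "X \<in> measurable M A" and W: "W \<in> measurable M B"
    and I: "indep_set {X -` S \<inter> space M | S. S \<in> sets A} {W -` S \<inter> space M | S. S \<in> sets B}"
    using indep by (auto simp: indep_rv_def)
  \<comment> \<open>Generic in \<open>f\<close>, \<open>X\<close> and the spaces, because it serves
    both variables.\<close>
  have sub: "{(\<lambda>\<omega>. f (X \<omega>)) -` U \<inter> space M |U. U \<in> sets N} \<subseteq> {X -` S \<inter> space M | S. S \<in> sets A}"
    if f: "f \<in> measurable A N" and X: "X \<in> measurable M A"
    for f :: "'x \<Rightarrow> 'y" and X A N
  proof -
    have "(\<lambda>\<omega>. f (X \<omega>)) -` U \<inter> space M = X -` (f -` U \<inter> space A) \<inter> space M" for U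
      using measurable_space[OF X] by auto
    then show ?thesis
      using measurable_sets[OF f] by blast
  qed
  have "indep_set {(\<lambda>\<omega>. f (X \<omega>)) -` U \<inter> space M |U. U \<in> sets N}
      {(\<lambda>\<omega>. g (W \<omega>)) -` U \<inter> space M |U. U \<in> sets N'}"
    using indep_set_mono[OF I sub[OF f X] sub[OF g W]] .
  then show ?thesis
    unfolding indep_var_eq
    using measurable_compose[OF X f] measurable_compose[OF W g]
    by (auto intro!: indep_set_sigma_sets Int_stable_vimage_sets)
qed

text \<open>The left side is the expectation of \<open>h (X \<omega>)\<close> times the indicator of
  \<open>S\<close> at \<open>W \<omega>\<close>. These are independent real variables, so the
  expectation factors.\<close>

lemma (in prob_space) indep_rv_set_integral:
  fixes h :: "'b \<Rightarrow> real"
  assumes indep: "indep_rv M A X B W"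
    and h: "h \<in> borel_measurable A"
    and int: "integrable M (\<lambda>\<omega>. h (X \<omega>))"
    and S: "S \<in> sets B"
  shows "(LINT \<omega>:{\<omega> \<in> space M. W \<omega> \<in> S}|M. h (X \<omega>)) =
    prob {\<omega> \<in> space M. W \<omega> \<in> S} * (LINT \<omega>|M. h (X \<omega>))"
proof -
  let ?S = "{\<omega> \<in> space M. W \<omega> \<in> S}"
  have W: "W \<in> measurable M B"
    using indep by (auto simp: indep_rv_def)
  have S': "?S \<in> sets M"
    using measurable_sets[OF W S] by (simp add: vimage_def Int_def conj_commute)
  have "(LINT \<omega>:?S|M. h (X \<omega>)) = (LINT \<omega>|M. h (X \<omega>) * indicator S (W \<omega>))"
    unfolding set_lebesgue_integral_def
    by (intro Bochner_Integration.integral_cong) (auto simp: indicator_def)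
  also have "\<dots> = (LINT \<omega>|M. h (X \<omega>)) * (LINT \<omega>|M. indicator S (W \<omega>))"
  proof (rule indep_var_lebesgue_integral)
    show "integrable M (\<lambda>\<omega>. h (X \<omega>))" by (fact int)
    have "integrable M (indicator ?S :: _ \<Rightarrow> real)"
      by (rule integrable_real_indicator[OF S']) (simp add: emeasure_eq_measure)
    then show "integrable M (\<lambda>\<omega>. indicator S (W \<omega>) :: real)"
      by (rule Bochner_Integration.integrable_cong[THEN iffD1, rotated -1]) (auto simp: indicator_def)
    show "indep_var borel (\<lambda>\<omega>. h (X \<omega>)) borel (\<lambda>\<omega>. indicator S (W \<omega>) :: real)"
      by (rule indep_var_compose_rv[OF indep h]) (use S in simp)
  qed
  also have "(LINT \<omega>|M. indicator S (W \<omega>) :: real) = (LINT \<omega>|M. indicator ?S \<omega>)"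
    by (intro Bochner_Integration.integral_cong) (auto simp: indicator_def)
  also have "\<dots> = prob ?S" using S' by simp
  finally show ?thesis by (simp add: mult.commute)
qed

section \<open>First treatment periods and the observed outcome\<close>

text \<open>For \<open>k \<ge> 1\<close> this is the event \<open>A(z) = k\<close>. Stated without a
  least element, it is a finite Boolean combination of treatment statuses, hence visibly measurable,
  and it is false for every \<open>k \<ge> 1\<close> on a never-treated path.\<close>

definition first_treated :: "(nat \<Rightarrow> bool \<Rightarrow> 'a \<Rightarrow> bool) \<Rightarrow> nat \<Rightarrow> bool \<Rightarrow> 'a \<Rightarrow> bool" where
  "first_treated D k z \<omega> \<longleftrightarrow> D k z \<omega> \<and> (\<forall>j\<in>{1..<k}. \<not> D j z \<omega>)"

lemma sum_first_treated:
  fixes w :: "nat \<Rightarrow> real"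
  assumes k: "k \<in> {1..t}" "first_treated D k z \<omega>"
  shows "(\<Sum>j=1..t. of_bool (first_treated D j z \<omega>) * w j) = w k"
proof -
  have "first_treated D j z \<omega> \<longleftrightarrow> j = k" if "j \<in> {1..t}" for j
    using that k by (cases j k rule: linorder_cases) (auto simp: first_treated_def)
  then have "(\<Sum>j=1..t. of_bool (first_treated D j z \<omega>) * w j) = (\<Sum>j=1..t. if j = k then w j else 0)"
    by (intro sum.cong) auto
  then show ?thesis using k by simp
qed

lemma ex_first_treated:
  assumes "s \<in> {1..t}" "D s z \<omega>"
  shows "\<exists>k\<in>{1..t}. first_treated D k z \<omega>"
proof -
  define k where "k = (LEAST s. s \<in> {1..t} \<and> D s z \<omega>)"
  have k: "k \<in> {1..t} \<and> D k z \<omega>"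
    unfolding k_def by (rule LeastI[of _ s]) (use assms in simp)
  have "\<not> D j z \<omega>" if "j \<in> {1..<k}" for j
    using not_less_Least[of j "\<lambda>s. s \<in> {1..t} \<and> D s z \<omega>", folded k_def] that k by auto
  with k show ?thesis
    by (auto simp: first_treated_def)
qed

text \<open>At most one period is the first treated one, so the case distinction and the
  \<open>LEAST\<close> become a sum that is linear in indicators and can be integrated term by
  term.\<close>

lemma observed_outcome_eq:
  "observed_outcome Z D Y0z Y1z t \<omega> = Y0z t (Z \<omega>) \<omega> +
    (\<Sum>k=1..t. of_bool (first_treated D k (Z \<omega>) \<omega>) * (Y1z t (t - k) (Z \<omega>) \<omega> - Y0z t (Z \<omega>) \<omega>))"
proof (cases "\<exists>s\<in>{1..t}. D s (Z \<omega>) \<omega>")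
  case True
  then obtain k where k: "k \<in> {1..t}" "first_treated D k (Z \<omega>) \<omega>"
    using ex_first_treated[of _ t D "Z \<omega>" \<omega>] by blast
  then have "(LEAST s. s \<in> {1..t} \<and> D s (Z \<omega>) \<omega>) = k"
    by (intro Least_equality) (force simp: first_treated_def not_less[symmetric])+
  then show ?thesis
    using True sum_first_treated[OF k] by (simp add: observed_outcome_def observed_treatment_def)
next
  case False
  then have "\<not> first_treated D k (Z \<omega>) \<omega>" if "k \<in> {1..t}" for k
    using that by (auto simp: first_treated_def)
  with False show ?thesis by (simp add: observed_outcome_def observed_treatment_def)
qed

section \<open>Latent groups as type histories\<close>

fun type_of :: "bool \<Rightarrow> bool \<Rightarrow> latent_type" where
  "type_of True True = AT"
| "type_of True False = C"
| "type_of False True = F"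
| "type_of False False = NT"

lemma type_of_eq_iff:
  "type_of a b = AT \<longleftrightarrow> a \<and> b" "type_of a b = C \<longleftrightarrow> a \<and> \<not> b"
  "type_of a b = F \<longleftrightarrow> \<not> a \<and> b" "type_of a b = NT \<longleftrightarrow> \<not> a \<and> \<not> b"
  by (cases a; cases b; simp_all)+

text \<open>The types of one unit in periods 1 to \<open>k\<close>, encoded as a group. Membership
  in a group event thereby becomes an equation of lists, and events of distinct groups of equal
  length are seen to be disjoint.\<close>

definition history :: "(nat \<Rightarrow> bool \<Rightarrow> 'a \<Rightarrow> bool) \<Rightarrow> nat \<Rightarrow> 'a \<Rightarrow> latent_group" where
  "history D k \<omega> = map (\<lambda>j. type_of (D (j + 1) True \<omega>) (D (j + 1) False \<omega>)) [0..<k]"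

lemma length_history [simp]: "length (history D k \<omega>) = k"
  by (simp add: history_def)

lemma mem_type_event_iff:
  "\<omega> \<in> type_event M D t y \<longleftrightarrow> \<omega> \<in> space M \<and> type_of (D t True \<omega>) (D t False \<omega>) = y"
  by (cases y) (auto simp: type_of_eq_iff)

lemma group_event_eq: "group_event M D g = {\<omega> \<in> space M. history D (length g) \<omega> = g}"
proof -
  have "history D (length g) \<omega> = g \<longleftrightarrow>
    (\<forall>j<length g. type_of (D (j + 1) True \<omega>) (D (j + 1) False \<omega>) = g ! j)" for \<omega>
    unfolding history_def by (subst list_eq_iff_nth_eq) simp
  then show ?thesis
    unfolding group_event_def mem_type_event_iff by blast
qed

text \<open>Every member of \<open>Gplus k\<close> and \<open>Gminus k\<close> has this shape: NT
  before \<open>l\<close>, a constant type \<open>a\<close> from \<open>l\<close> to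
  \<open>k - 1\<close>, and \<open>b\<close> at \<open>k\<close>. The middle block is empty for
  \<open>l = k\<close>, the initial one for \<open>l = 1\<close>.\<close>

lemma history_eq_iff:
  assumes "1 \<le> l" "l \<le> k"
  shows "history D k \<omega> = replicate (l - 1) NT @ replicate (k - l) a @ [b] \<longleftrightarrow>
    (\<forall>j\<in>{1..<l}. \<not> D j True \<omega> \<and> \<not> D j False \<omega>) \<and>
    (\<forall>j\<in>{l..<k}. type_of (D j True \<omega>) (D j False \<omega>) = a) \<and>
    type_of (D k True \<omega>) (D k False \<omega>) = b"
proof -
  let ?t = "\<lambda>j. type_of (D j True \<omega>) (D j False \<omega>)"
  have "history D k \<omega> = map ?t [1..<l] @ map ?t [l..<k] @ [?t k]"
  proof -
    have "history D k \<omega> = map ?t (map Suc [0..<k])"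
      by (simp add: history_def)
    also have "map Suc [0..<k] = [1..<Suc k]" by (simp add: map_Suc_upt)
    also have "\<dots> = [1..<l] @ [l..<k] @ [k]"
      using assms upt_add_eq_append[of 1 l "k - l"] by simp
    finally show ?thesis by simp
  qed
  moreover have "map ?t xs = replicate n y \<longleftrightarrow> (\<forall>j\<in>set xs. ?t j = y)" if "length xs = n" for xs n y
    using that by (auto simp: map_replicate_const[symmetric] simp flip: that)
  ultimately show ?thesis
    by (auto simp: type_of_eq_iff)
qed

text \<open>An empty \<open>F\<close> block is inserted into the first group so that all members
  have the shape of \<open>history_eq_iff\<close>.\<close>

lemma Gplus_eq:
  assumes "2 \<le> k"
  shows "Gplus k = {replicate (k - 1) NT @ replicate (k - k) F @ [C]} \<union>
    {replicate (l - 1) NT @ replicate (k - l) F @ [AT] | l. l \<in> {2..k - 1}}"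
  by (simp add: Gplus_def)

text \<open>The group C up to \<open>k - 1\<close>, then AT, is the case \<open>l = 1\<close> of the
  parametric family and is absorbed into it.\<close>

lemma Gminus_eq:
  assumes "2 \<le> k"
  shows "Gminus k = {replicate (k - 1) NT @ replicate (k - k) C @ [F]} \<union>
    {replicate (l - 1) NT @ replicate (k - l) C @ [AT] | l. l \<in> {1..k - 1}}"
proof -
  have "{1..k - 1} = insert 1 {2..k - 1}" using assms by auto
  then show ?thesis
    unfolding Gminus_def Setcompr_eq_image by (simp add: insert_commute)
qed

text \<open>Let treatment under \<open>True\<close> start at \<open>k\<close>, and not under
  \<open>False\<close>. If the \<open>False\<close> path is untreated at \<open>k\<close>,
  irreversibility makes it untreated before, which gives NT up to \<open>k - 1\<close>, then C.
  Otherwise it starts at some \<open>l < k\<close>, and the unit is NT before \<open>l\<close>, F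
  from \<open>l\<close> to \<open>k - 1\<close>, and AT at \<open>k\<close>.\<close>

lemma history_in_Gplus_iff:
  assumes k: "2 \<le> k"
    and mono: "\<And>i j z. 1 \<le> i \<Longrightarrow> i \<le> j \<Longrightarrow> j \<le> k \<Longrightarrow> D i z \<omega> \<Longrightarrow> D j z \<omega>"
    and no_F: "\<not> (\<not> D 1 True \<omega> \<and> D 1 False \<omega>)"
  shows "history D k \<omega> \<in> Gplus k \<longleftrightarrow> first_treated D k True \<omega> \<and> \<not> first_treated D k False \<omega>"
    (is "?L \<longleftrightarrow> ?R")
proof -
  have L: "?L \<longleftrightarrow> ((\<forall>j\<in>{1..<k}. \<not> D j True \<omega> \<and> \<not> D j False \<omega>) \<and> D k True \<omega> \<and> \<not> D k False \<omega>) \<or>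
    (\<exists>l\<in>{2..k-1}. (\<forall>j\<in>{1..<l}. \<not> D j True \<omega> \<and> \<not> D j False \<omega>) \<and>
      (\<forall>j\<in>{l..<k}. \<not> D j True \<omega> \<and> D j False \<omega>) \<and> D k True \<omega> \<and> D k False \<omega>)"
    (is "_ \<longleftrightarrow> ?A \<or> ?B")
  proof -
    have "?L \<longleftrightarrow> history D k \<omega> = replicate (k - 1) NT @ replicate (k - k) F @ [C] \<or>
      (\<exists>l\<in>{2..k-1}. history D k \<omega> = replicate (l - 1) NT @ replicate (k - l) F @ [AT])"
      unfolding Gplus_eq[OF k] by blast
    also have "\<dots> \<longleftrightarrow> ?A \<or> ?B"
    proof (intro arg_cong2[where f = "(\<or>)"] bex_cong refl)
      show "history D k \<omega> = replicate (k - 1) NT @ replicate (k - k) F @ [C] \<longleftrightarrow> ?A"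
        by (subst history_eq_iff) (use k in \<open>simp_all add: type_of_eq_iff\<close>)
      show "history D k \<omega> = replicate (l - 1) NT @ replicate (k - l) F @ [AT] \<longleftrightarrow>
        (\<forall>j\<in>{1..<l}. \<not> D j True \<omega> \<and> \<not> D j False \<omega>) \<and>
        (\<forall>j\<in>{l..<k}. \<not> D j True \<omega> \<and> D j False \<omega>) \<and> D k True \<omega> \<and> D k False \<omega>"
        if "l \<in> {2..k - 1}" for l
        by (subst history_eq_iff) (use that k in \<open>auto simp: type_of_eq_iff\<close>)
    qed
    finally show ?thesis .
  qed
  show ?thesis
  proof
    assume ?L
    then show ?R unfolding L
    proof
      assume ?A then show ?R by (auto simp: first_treated_def)
    next
      assume ?B
      then obtain l where l: "l \<in> {2..k-1}" "\<forall>j\<in>{1..<l}. \<not> D j True \<omega> \<and> \<not> D j False \<omega>"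
        "\<forall>j\<in>{l..<k}. \<not> D j True \<omega> \<and> D j False \<omega>" "D k True \<omega>" by blast
      then have "\<not> D j True \<omega>" if "j \<in> {1..<k}" for j using that by (cases "j < l") auto
      moreover have "D l False \<omega>" "l \<in> {1..<k}" using l by auto
      ultimately show ?R using l unfolding first_treated_def by blast
    qed
  next
    assume R: ?R
    then have R1: "D k True \<omega>" "\<And>j. j \<in> {1..<k} \<Longrightarrow> \<not> D j True \<omega>"
      by (auto simp: first_treated_def)
    show ?L
    proof (cases "D k False \<omega>")
      case False
      then have "\<not> D j False \<omega>" if "j \<in> {1..<k}" for j using mono[of j k False] that by auto
      with False R1 show ?thesis unfolding L by blast
    next
      case True
      with R obtain s where s: "s \<in> {1..<k}" "D s False \<omega>" by (auto simp: first_treated_def)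
      then have "s \<in> {1..k-1}" by auto
      with s obtain l where l: "l \<in> {1..k-1}" "first_treated D l False \<omega>"
        using ex_first_treated by metis
      \<comment> \<open>The family in \<open>Gplus k\<close> starts at \<open>l = 2\<close>. A start
        at \<open>l = 1\<close> would make the unit a defier in period 1, which \<open>no_F\<close>
        rules out.\<close>
      have "l \<noteq> 1" using l no_F R1(2)[of 1] k by (auto simp: first_treated_def)
      moreover have "D j False \<omega>" if "j \<in> {l..<k}" for j
        using mono[of l j False] l that by (auto simp: first_treated_def)
      ultimately have ?B using l R1 True
        by (intro bexI[of _ l]) (auto simp: first_treated_def)
      then show ?thesis unfolding L by blast
    qed
  qed
qed

text \<open>The argument of \<open>history_in_Gplus_iff\<close> with the instrument values, and so C
  and F, exchanged. Here \<open>l = 1\<close> is admissible and yields the group C up to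
  \<open>k - 1\<close>, then AT.\<close>

lemma history_in_Gminus_iff:
  assumes k: "2 \<le> k"
    and mono: "\<And>i j z. 1 \<le> i \<Longrightarrow> i \<le> j \<Longrightarrow> j \<le> k \<Longrightarrow> D i z \<omega> \<Longrightarrow> D j z \<omega>"
  shows "history D k \<omega> \<in> Gminus k \<longleftrightarrow> first_treated D k False \<omega> \<and> \<not> first_treated D k True \<omega>"
    (is "?L \<longleftrightarrow> ?R")
proof -
  have L: "?L \<longleftrightarrow> ((\<forall>j\<in>{1..<k}. \<not> D j True \<omega> \<and> \<not> D j False \<omega>) \<and> \<not> D k True \<omega> \<and> D k False \<omega>) \<or>
    (\<exists>l\<in>{1..k-1}. (\<forall>j\<in>{1..<l}. \<not> D j True \<omega> \<and> \<not> D j False \<omega>) \<and>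
      (\<forall>j\<in>{l..<k}. D j True \<omega> \<and> \<not> D j False \<omega>) \<and> D k True \<omega> \<and> D k False \<omega>)"
    (is "_ \<longleftrightarrow> ?A \<or> ?B")
  proof -
    have "?L \<longleftrightarrow> history D k \<omega> = replicate (k - 1) NT @ replicate (k - k) C @ [F] \<or>
      (\<exists>l\<in>{1..k-1}. history D k \<omega> = replicate (l - 1) NT @ replicate (k - l) C @ [AT])"
      unfolding Gminus_eq[OF k] by blast
    also have "\<dots> \<longleftrightarrow> ?A \<or> ?B"
    proof (intro arg_cong2[where f = "(\<or>)"] bex_cong refl)
      show "history D k \<omega> = replicate (k - 1) NT @ replicate (k - k) C @ [F] \<longleftrightarrow> ?A"
        by (subst history_eq_iff) (use k in \<open>simp_all add: type_of_eq_iff\<close>)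
      show "history D k \<omega> = replicate (l - 1) NT @ replicate (k - l) C @ [AT] \<longleftrightarrow>
        (\<forall>j\<in>{1..<l}. \<not> D j True \<omega> \<and> \<not> D j False \<omega>) \<and>
        (\<forall>j\<in>{l..<k}. D j True \<omega> \<and> \<not> D j False \<omega>) \<and> D k True \<omega> \<and> D k False \<omega>"
        if "l \<in> {1..k - 1}" for l
        by (subst history_eq_iff) (use that k in \<open>auto simp: type_of_eq_iff\<close>)
    qed
    finally show ?thesis .
  qed
  show ?thesis
  proof
    assume ?L
    then show ?R unfolding L
    proof
      assume ?A then show ?R by (auto simp: first_treated_def)
    next
      assume ?B
      then obtain l where l: "l \<in> {1..k-1}" "\<forall>j\<in>{1..<l}. \<not> D j True \<omega> \<and> \<not> D j False \<omega>"
        "\<forall>j\<in>{l..<k}. D j True \<omega> \<and> \<not> D j False \<omega>" "D k False \<omega>" by blast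
      then have "\<not> D j False \<omega>" if "j \<in> {1..<k}" for j using that by (cases "j < l") auto
      moreover have "D l True \<omega>" "l \<in> {1..<k}" using l by auto
      ultimately show ?R using l unfolding first_treated_def by blast
    qed
  next
    assume R: ?R
    then have R1: "D k False \<omega>" "\<And>j. j \<in> {1..<k} \<Longrightarrow> \<not> D j False \<omega>"
      by (auto simp: first_treated_def)
    show ?L
    proof (cases "D k True \<omega>")
      case False
      then have "\<not> D j True \<omega>" if "j \<in> {1..<k}" for j using mono[of j k True] that by auto
      with False R1 show ?thesis unfolding L by blast
    next
      case True
      with R obtain s where s: "s \<in> {1..<k}" "D s True \<omega>" by (auto simp: first_treated_def)
      then have "s \<in> {1..k-1}" by auto
      with s obtain l where l: "l \<in> {1..k-1}" "first_treated D l True \<omega>"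
        using ex_first_treated by metis
      moreover have "D j True \<omega>" if "j \<in> {l..<k}" for j
        using mono[of l j True] l that by (auto simp: first_treated_def)
      ultimately have ?B using l R1 True
        by (intro bexI[of _ l]) (auto simp: first_treated_def)
      then show ?thesis unfolding L by blast
    qed
  qed
qed

lemma finite_Gplus: "finite (Gplus k)" and finite_Gminus: "finite (Gminus k)"
  by (auto simp: Gplus_def Gminus_def)

lemma length_Gplus: "g \<in> Gplus k \<Longrightarrow> 2 \<le> k \<Longrightarrow> length g = k"
  by (auto simp: Gplus_def)

lemma length_Gminus: "g \<in> Gminus k \<Longrightarrow> 2 \<le> k \<Longrightarrow> length g = k"
  by (auto simp: Gminus_def)

text \<open>Groups of the same length have disjoint events, so only the unit's own history can
  contribute.\<close>

lemma sum_indicator_group_event: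
  fixes M :: "'a measure"
  assumes "finite G" "\<And>g. g \<in> G \<Longrightarrow> length g = k" "\<omega> \<in> space M"
  shows "(\<Sum>g\<in>G. indicator (group_event M D g) \<omega>) = (of_bool (history D k \<omega> \<in> G) :: real)"
proof -
  have "(\<Sum>g\<in>G. indicator (group_event M D g) \<omega>) = (\<Sum>g\<in>G. if g = history D k \<omega> then 1 else 0 :: real)"
    using assms by (intro sum.cong) (auto simp: group_event_eq)
  then show ?thesis using assms(1) by simp
qed

text \<open>The difference is 1 or -1 exactly when one of the two membership criteria holds. If both
  paths or neither start at \<open>k\<close>, both sides vanish.\<close>

lemma first_treated_diff_eq_groups:
  fixes M :: "'a measure"
  assumes k: "2 \<le> k"
    and mono: "\<And>i j z. 1 \<le> i \<Longrightarrow> i \<le> j \<Longrightarrow> j \<le> k \<Longrightarrow> D i z \<omega> \<Longrightarrow> D j z \<omega>"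
    and no_F: "\<not> (\<not> D 1 True \<omega> \<and> D 1 False \<omega>)"
    and \<omega>: "\<omega> \<in> space M"
  shows "of_bool (first_treated D k True \<omega>) - of_bool (first_treated D k False \<omega>) =
    (\<Sum>g\<in>Gplus k. indicator (group_event M D g) \<omega>) -
    (\<Sum>g\<in>Gminus k. indicator (group_event M D g) \<omega> :: real)"
proof -
  have "(\<Sum>g\<in>Gplus k. indicator (group_event M D g) \<omega> :: real) = of_bool (history D k \<omega> \<in> Gplus k)"
    by (intro sum_indicator_group_event finite_Gplus length_Gplus k \<omega>)
  moreover have "(\<Sum>g\<in>Gminus k. indicator (group_event M D g) \<omega> :: real) = of_bool (history D k \<omega> \<in> Gminus k)"
    by (intro sum_indicator_group_event finite_Gminus length_Gminus k \<omega>)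
  moreover have "history D k \<omega> \<in> Gplus k \<longleftrightarrow> first_treated D k True \<omega> \<and> \<not> first_treated D k False \<omega>"
    by (rule history_in_Gplus_iff) (use k no_F mono in blast)+
  moreover have "history D k \<omega> \<in> Gminus k \<longleftrightarrow> first_treated D k False \<omega> \<and> \<not> first_treated D k True \<omega>"
    by (rule history_in_Gminus_iff) (use k mono in blast)+
  ultimately show ?thesis
    by (simp only: of_bool_def) simp
qed

section \<open>The model and its vector of latent variables\<close>

locale iv_model = iv_setting M T Z D Y0z Y1z
  for M :: "'a measure" and T Z D Y0z Y1z +
  fixes Y0 :: "nat \<Rightarrow> 'a \<Rightarrow> real" and Y1 :: "nat \<Rightarrow> nat \<Rightarrow> 'a \<Rightarrow> real"
  assumes irreversible: "irreversible_treatment M T Z D"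
    and exclusion: "exclusion M T Y0z Y1z Y0 Y1"
    and independence: "independence M T Z D Y0 Y1"
    and FS1_nonzero: "FS M Z D 1 \<noteq> 0"
    and F1_null: "measure M (type_event M D 1 F) = 0"

lemma iv_assumptions_iff_iv_model:
  "iv_assumptions M T Z D Y0z Y1z Y0 Y1 \<longleftrightarrow> iv_model M T Z D Y0z Y1z Y0 Y1"
  unfolding iv_assumptions_def iv_model_def iv_model_axioms_def by blast

type_synonym latent_vector = "real \<times> (nat \<Rightarrow> real) \<times> (nat \<times> bool \<Rightarrow> bool)"

text \<open>The value space in \<open>independence\<close>, named so that integrands can be written
  as \<open>h (X t \<omega>)\<close> with \<open>h\<close> measurable on this space, the form in
  which independence of \<open>Z\<close> is used.\<close>

definition latent_measure :: "nat \<Rightarrow> latent_vector measure" where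
  "latent_measure t =
    borel \<Otimes>\<^sub>M (\<Pi>\<^sub>M \<tau>\<in>{0..t - 1}. borel) \<Otimes>\<^sub>M (\<Pi>\<^sub>M p\<in>{1..t} \<times> UNIV. count_space UNIV)"

definition latent_vector ::
  "(nat \<Rightarrow> bool \<Rightarrow> 'a \<Rightarrow> bool) \<Rightarrow> (nat \<Rightarrow> 'a \<Rightarrow> real) \<Rightarrow> (nat \<Rightarrow> nat \<Rightarrow> 'a \<Rightarrow> real)
    \<Rightarrow> nat \<Rightarrow> 'a \<Rightarrow> latent_vector" where
  "latent_vector D Y0 Y1 t \<omega> =
    (Y0 t \<omega>, (\<lambda>\<tau>\<in>{0..t - 1}. Y1 t \<tau> \<omega>), (\<lambda>(s, z)\<in>{1..t} \<times> UNIV. D s z \<omega>))"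

lemma measurable_latent_Y0: "fst \<in> borel_measurable (latent_measure t)"
  by (simp add: latent_measure_def)

lemma measurable_latent_Y1:
  assumes "\<tau> \<in> {0..t - 1}"
  shows "(\<lambda>x. fst (snd x) \<tau>) \<in> borel_measurable (latent_measure t)"
  unfolding latent_measure_def
  by (rule measurable_compose[OF measurable_compose[OF measurable_snd measurable_fst]
        measurable_component_singleton[OF assms]])

lemma measurable_latent_D:
  assumes "s \<in> {1..t}"
  shows "(\<lambda>x. snd (snd x) (s, z)) \<in> measurable (latent_measure t) (count_space UNIV)"
  unfolding latent_measure_def
  by (rule measurable_compose[OF measurable_compose[OF measurable_snd measurable_snd]
        measurable_component_singleton]) (use assms in auto)

lemma measurable_latent_first_treated:
  assumes "k \<in> {1..t}"
  shows "(\<lambda>x. of_bool (snd (snd x) (k, z) \<and> (\<forall>j\<in>{1..<k}. \<not> snd (snd x) (j, z))) :: real)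
    \<in> borel_measurable (latent_measure t)"
proof -
  have [measurable]: "Measurable.pred (latent_measure t) (\<lambda>x. snd (snd x) (s, z))" if "s \<in> {1..k}" for s
    using that assms by (intro measurable_latent_D) auto
  have "Measurable.pred (latent_measure t) (\<lambda>x. snd (snd x) (k, z) \<and> (\<forall>j\<in>{1..<k}. \<not> snd (snd x) (j, z)))"
    using assms by (intro pred_intros_logic pred_intros_finite) auto
  then show ?thesis
    by (rule measurable_compose) simp
qed

context iv_model
begin

abbreviation "X \<equiv> latent_vector D Y0 Y1"

lemma indep_X_Z:
  assumes "t \<in> {1..T}"
  shows "indep_rv M (latent_measure t) (X t) (count_space UNIV) Z"
  using independence assms
  unfolding independence_def latent_measure_def latent_vector_def[abs_def] by blast

lemma measurable_X: "t \<in> {1..T} \<Longrightarrow> X t \<in> measurable M (latent_measure t)"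
  using indep_X_Z unfolding indep_rv_def by blast

lemma X_D: "s \<in> {1..t} \<Longrightarrow> snd (snd (X t \<omega>)) (s, z) = D s z \<omega>"
  by (simp add: latent_vector_def)

lemma X_Y0: "fst (X t \<omega>) = Y0 t \<omega>"
  by (simp add: latent_vector_def)

lemma X_Y1: "\<tau> \<in> {0..t - 1} \<Longrightarrow> fst (snd (X t \<omega>)) \<tau> = Y1 t \<tau> \<omega>"
  by (simp add: latent_vector_def)

lemma X_first_treated:
  assumes "k \<in> {1..t}"
  shows "(snd (snd (X t \<omega>)) (k, z) \<and> (\<forall>j\<in>{1..<k}. \<not> snd (snd (X t \<omega>)) (j, z))) =
    first_treated D k z \<omega>"
  using assms by (auto simp: first_treated_def X_D)

lemma measurable_Y0: "t \<in> {1..T} \<Longrightarrow> Y0 t \<in> borel_measurable M"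
  using measurable_compose[OF measurable_X measurable_latent_Y0] by (simp add: X_Y0)

lemma measurable_Y1: "t \<in> {1..T} \<Longrightarrow> \<tau> \<in> {0..t - 1} \<Longrightarrow> Y1 t \<tau> \<in> borel_measurable M"
  using measurable_compose[OF measurable_X measurable_latent_Y1] by (simp add: X_Y1)

text \<open>Integrability is assumed for \<open>Y0z\<close> and passes to \<open>Y0\<close> through
  the almost sure equality in exclusion; the instrument value \<open>True\<close> is an arbitrary
  choice. Measurability of \<open>Y0\<close> comes from the measurability clause of
  \<open>indep_rv\<close>.\<close>

lemma integrable_Y0:
  assumes t: "t \<in> {1..T}"
  shows "integrable M (Y0 t)"
proof -
  have "AE \<omega> in M. Y0z t True \<omega> = Y0 t \<omega>"
    using exclusion t unfolding exclusion_def by blast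
  then show ?thesis
    using Bochner_Integration.integrable_cong_AE[of "Y0z t True" M "Y0 t"]
      Y0z_integrable[OF t] measurable_Y0[OF t] by auto
qed

lemma integrable_Y1:
  assumes t: "t \<in> {1..T}" "\<tau> \<in> {0..t - 1}"
  shows "integrable M (Y1 t \<tau>)"
proof -
  have "AE \<omega> in M. Y1z t \<tau> True \<omega> = Y1 t \<tau> \<omega>"
    using exclusion t unfolding exclusion_def by blast
  then show ?thesis
    using Bochner_Integration.integrable_cong_AE[of "Y1z t \<tau> True" M "Y1 t \<tau>"]
      Y1z_integrable[OF t] measurable_Y1[OF t] by auto
qed

lemma pred_Z [measurable]: "Measurable.pred M Z"
  using Z_measurable .

lemma pred_D: "t \<in> {1..T} \<Longrightarrow> Measurable.pred M (D t z)"
  using D_measurable .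

lemma measurable_first_treated:
  assumes "k \<in> {1..T}"
  shows "(\<lambda>\<omega>. of_bool (first_treated D k z \<omega>) :: real) \<in> borel_measurable M"
  \<comment> \<open>The vector of period \<open>k\<close> itself suffices: being first treated at
    \<open>k\<close> depends only on statuses up to \<open>k\<close>.\<close>
  using measurable_compose[OF measurable_X[OF assms] measurable_latent_first_treated[of k k z]] assms
    X_first_treated[of k k _ z]
  by simp

section \<open>Conditioning on the instrument and almost sure properties of paths\<close>

lemma prob_Z_pos: "0 < prob {\<omega> \<in> space M. Z \<omega> = z}"
proof (cases z)
  case False
  have "prob {\<omega> \<in> space M. \<not> Z \<omega>} = 1 - prob {\<omega> \<in> space M. Z \<omega>}"
    by (rule prob_neg) measurable
  then show ?thesis using False Z_nondegenerate by simp
qed (use Z_nondegenerate in simp)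

lemma set_integral_Z:
  assumes t: "t \<in> {1..T}"
    and h: "h \<in> borel_measurable (latent_measure t)" "integrable M (\<lambda>\<omega>. h (X t \<omega>))"
  shows "(LINT \<omega>:{\<omega> \<in> space M. Z \<omega> = z}|M. h (X t \<omega>)) =
    prob {\<omega> \<in> space M. Z \<omega> = z} * (LINT \<omega>|M. h (X t \<omega>))"
  using indep_rv_set_integral[OF indep_X_Z[OF t] h, of "{z}"] by simp

text \<open>On the event \<open>Z = z\<close> an observed variable \<open>V\<close> coincides with
  its counterfactual version \<open>h (X t \<omega>)\<close>. Independence then removes the
  conditioning, and the positive probability of the event cancels.\<close>

lemma cexp_Z:
  assumes t: "t \<in> {1..T}"
    and h: "h \<in> borel_measurable (latent_measure t)" "integrable M (\<lambda>\<omega>. h (X t \<omega>))"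
    and V: "V \<in> borel_measurable M" "AE \<omega> in M. Z \<omega> = z \<longrightarrow> V \<omega> = h (X t \<omega>)"
  shows "cexp M V {\<omega> \<in> space M. Z \<omega> = z} = (LINT \<omega>|M. h (X t \<omega>))"
proof -
  note [measurable] = V(1) measurable_compose[OF measurable_X[OF t] h(1)]
  have "(LINT \<omega>:{\<omega> \<in> space M. Z \<omega> = z}|M. V \<omega>) =
      (LINT \<omega>:{\<omega> \<in> space M. Z \<omega> = z}|M. h (X t \<omega>))"
    unfolding set_lebesgue_integral_def
  proof (rule integral_cong_AE)
    show "AE \<omega> in M. indicat_real {\<omega> \<in> space M. Z \<omega> = z} \<omega> *\<^sub>R V \<omega> =
      indicat_real {\<omega> \<in> space M. Z \<omega> = z} \<omega> *\<^sub>R h (X t \<omega>)"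
      using V(2) by eventually_elim (auto simp: indicator_def)
  qed measurable
  then show ?thesis
    using set_integral_Z[OF t h, of z] prob_Z_pos[of z] by (simp add: cexp_def)
qed

text \<open>Irreversibility is assumed only for the observed treatment path; independence carries it over
  to both potential paths.\<close>

lemma AE_potential_irreversible:
  assumes s: "s \<in> {1..T} - {T}"
  shows "AE \<omega> in M. D s z \<omega> \<longrightarrow> D (s + 1) z \<omega>"
proof -
  \<comment> \<open>The indicator of a reversal between \<open>s\<close> and \<open>s + 1\<close> on
    the path under \<open>z\<close>, as a function of the latent vector of period
    \<open>s + 1\<close>.\<close>
  let ?h = "\<lambda>x. of_bool (snd (snd x) (s, z) \<and> \<not> snd (snd x) (s + 1, z)) :: real"
  have t: "s + 1 \<in> {1..T}" using s by auto
  have [measurable]: "Measurable.pred (latent_measure (s + 1)) (\<lambda>x. snd (snd x) (s, z))"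
    "Measurable.pred (latent_measure (s + 1)) (\<lambda>x. snd (snd x) (s + 1, z))"
    using s by (auto intro!: measurable_latent_D)
  have h: "?h \<in> borel_measurable (latent_measure (s + 1))" by measurable
  have eq: "?h (X (s + 1) \<omega>) = of_bool (D s z \<omega> \<and> \<not> D (s + 1) z \<omega>)" for \<omega>
    using s by (simp add: X_D)
  have int: "integrable M (\<lambda>\<omega>. ?h (X (s + 1) \<omega>))"
    by (rule integrable_const_bound[of _ 1])
      (use measurable_compose[OF measurable_X[OF t] h] in simp_all)
  have "AE \<omega> in M. Z \<omega> = z \<longrightarrow> 0 = ?h (X (s + 1) \<omega>)"
  proof -
    have "AE \<omega> in M. observed_treatment Z D s \<omega> \<longrightarrow> observed_treatment Z D (s + 1) \<omega>"
      using irreversible s unfolding irreversible_treatment_def by blast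
    then show ?thesis
      unfolding eq by eventually_elim (auto simp: observed_treatment_def)
  qed
  \<comment> \<open>No reversal is observed when \<open>Z = z\<close>, so \<open>cexp_Z\<close>
    applies with the zero function as \<open>V\<close> and shows that the unconditional probability
    of a reversal under \<open>z\<close> is 0.\<close>
  then have "cexp M (\<lambda>_. 0) {\<omega> \<in> space M. Z \<omega> = z} = (LINT \<omega>|M. ?h (X (s + 1) \<omega>))"
    by (intro cexp_Z[OF t h int]) auto
  then have "(LINT \<omega>|M. ?h (X (s + 1) \<omega>)) = 0"
    by (simp add: cexp_def)
  then have "AE \<omega> in M. ?h (X (s + 1) \<omega>) = 0"
    using integral_nonneg_eq_0_iff_AE[OF int] by simp
  then show ?thesis
    unfolding eq by eventually_elim auto
qed

text \<open>The finitely many one-step implications hold simultaneously off a null set, and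
  induction chains them.\<close>

lemma AE_monotone_path:
  "AE \<omega> in M. \<forall>i j z. 1 \<le> i \<longrightarrow> i \<le> j \<longrightarrow> j \<le> T \<longrightarrow> D i z \<omega> \<longrightarrow> D j z \<omega>"
proof -
  have "AE \<omega> in M. \<forall>s\<in>{1..T} - {T}. \<forall>z. D s z \<omega> \<longrightarrow> D (s + 1) z \<omega>"
    using AE_potential_irreversible by (intro AE_finite_allI) (auto simp: all_bool_eq)
  then show ?thesis
  proof eventually_elim
    case (elim \<omega>)
    have "D j z \<omega>" if "i \<le> j" "1 \<le> i" "j \<le> T" "D i z \<omega>" for i j z
      using that
    proof (induction j rule: dec_induct)
      case (step n)
      then have "n \<in> {1..T} - {T}" "D n z \<omega>" by auto
      then show ?case using elim by auto
    qed
    then show ?case by blast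
  qed
qed

lemma AE_no_F1: "AE \<omega> in M. \<not> (\<not> D 1 True \<omega> \<and> D 1 False \<omega>)"
  if "1 \<le> T"
proof -
  have [measurable]: "Measurable.pred M (D 1 z)" for z using that by (intro pred_D) auto
  have "type_event M D 1 F \<in> events" unfolding type_event.simps by measurable
  moreover have "emeasure M (type_event M D 1 F) = 0"
    using F1_null by (simp add: emeasure_eq_measure)
  ultimately have "AE \<omega> in M. \<omega> \<notin> type_event M D 1 F"
    by (intro AE_not_in) (simp add: null_sets_def)
  then show ?thesis using AE_space by eventually_elim auto
qed

section \<open>Instrument contrasts as signed integrals over latent groups\<close>

lemma group_event_measurable:
  assumes "length g \<le> T"
  shows "group_event M D g \<in> events"
proof -
  have "{\<omega> \<in> space M. \<omega> \<in> type_event M D (j + 1) (g ! j)} \<in> events" if "j < length g" for j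
  proof -
    have [measurable]: "Measurable.pred M (D (j + 1) z)" for z
      using assms that by (intro pred_D) auto
    show ?thesis by (cases "g ! j"; simp only: type_event.simps mem_Collect_eq; measurable)
  qed
  then have "{\<omega> \<in> space M. \<forall>j\<in>{..<length g}. \<omega> \<in> type_event M D (j + 1) (g ! j)} \<in> events"
    by (intro sets.sets_Collect_finite_All) auto
  then show ?thesis by (simp only: group_event_def Ball_def lessThan_iff)
qed

lemma integrable_first_treated_times:
  assumes "k \<in> {1..T}" "integrable M W"
  shows "integrable M (\<lambda>\<omega>. of_bool (first_treated D k z \<omega>) * W \<omega> :: real)"
  by (rule Bochner_Integration.integrable_bound[OF assms(2)])
    (use measurable_first_treated[OF assms(1)] assms(2) in \<open>auto simp: of_bool_def\<close>)

text \<open>The contribution of first treatment in period \<open>k\<close> to an instrument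
  contrast. The integrand \<open>W\<close> is left free so that one decomposition serves both the
  reduced form (an outcome contrast) and the first stage (the constant 1).\<close>

definition effect_integral :: "nat \<Rightarrow> ('a \<Rightarrow> real) \<Rightarrow> real" where
  "effect_integral k W =
    (LINT \<omega>|M. (of_bool (first_treated D k True \<omega>) - of_bool (first_treated D k False \<omega>)) * W \<omega>)"

text \<open>The common form of \<open>RF\<close> and \<open>FS\<close>: \<open>u\<close> is the
  value without treatment and \<open>w k\<close> the gain from first treatment at \<open>k\<close>.
  By independence \<open>u\<close> has the same mean in both arms and cancels.\<close>

lemma cexp_diff:
  assumes t: "t \<in> {1..T}"
    and u: "u \<in> borel_measurable (latent_measure t)" "integrable M (\<lambda>\<omega>. u (X t \<omega>))"
    and w: "\<And>k. k \<in> {1..t} \<Longrightarrow> w k \<in> borel_measurable (latent_measure t)"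
      "\<And>k. k \<in> {1..t} \<Longrightarrow> integrable M (\<lambda>\<omega>. w k (X t \<omega>))"
    and V: "V \<in> borel_measurable M"
      "AE \<omega> in M. V \<omega> = u (X t \<omega>) + (\<Sum>k=1..t. of_bool (first_treated D k (Z \<omega>) \<omega>) * w k (X t \<omega>))"
  shows "cexp M V {\<omega> \<in> space M. Z \<omega>} - cexp M V {\<omega> \<in> space M. \<not> Z \<omega>} =
    (\<Sum>k=1..t. effect_integral k (\<lambda>\<omega>. w k (X t \<omega>)))"
proof -
  \<comment> \<open>\<open>V\<close> with the instrument frozen at \<open>z\<close>, written on the
    value space of the latent vector.\<close>
  define h where "h z x = u x +
    (\<Sum>k=1..t. of_bool (snd (snd x) (k, z) \<and> (\<forall>j\<in>{1..<k}. \<not> snd (snd x) (j, z))) * w k x)" for z x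
  have hX: "h z (X t \<omega>) = u (X t \<omega>) + (\<Sum>k=1..t. of_bool (first_treated D k z \<omega>) * w k (X t \<omega>))" for z \<omega>
    unfolding h_def by (intro arg_cong2[where f = "(+)"] sum.cong refl) (simp only: X_first_treated)
  have int: "integrable M (\<lambda>\<omega>. of_bool (first_treated D k z \<omega>) * w k (X t \<omega>))" if "k \<in> {1..t}" for k z
    using that t by (intro integrable_first_treated_times w) auto
  have c: "cexp M V {\<omega> \<in> space M. Z \<omega> = z} = (LINT \<omega>|M. u (X t \<omega>)) +
    (\<Sum>k=1..t. LINT \<omega>|M. of_bool (first_treated D k z \<omega>) * w k (X t \<omega>))" for z
  proof -
    have "cexp M V {\<omega> \<in> space M. Z \<omega> = z} = (LINT \<omega>|M. h z (X t \<omega>))"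
    proof (rule cexp_Z[OF t _ _ V(1)])
      show "h z \<in> borel_measurable (latent_measure t)"
        unfolding h_def
        by (intro borel_measurable_add borel_measurable_sum borel_measurable_times u w
            measurable_latent_first_treated)
      show "integrable M (\<lambda>\<omega>. h z (X t \<omega>))"
        unfolding hX by (intro Bochner_Integration.integrable_add Bochner_Integration.integrable_sum u int)
      show "AE \<omega> in M. Z \<omega> = z \<longrightarrow> V \<omega> = h z (X t \<omega>)"
        using V(2) unfolding hX by eventually_elim simp
    qed
    also have "\<dots> = (LINT \<omega>|M. u (X t \<omega>)) +
        (\<Sum>k=1..t. LINT \<omega>|M. of_bool (first_treated D k z \<omega>) * w k (X t \<omega>))"
      unfolding hX using u int
      by (simp only: Bochner_Integration.integral_add Bochner_Integration.integrable_sum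
          Bochner_Integration.integral_sum)
    finally show ?thesis .
  qed
  have "effect_integral k (\<lambda>\<omega>. w k (X t \<omega>)) =
      (LINT \<omega>|M. of_bool (first_treated D k True \<omega>) * w k (X t \<omega>)) -
      (LINT \<omega>|M. of_bool (first_treated D k False \<omega>) * w k (X t \<omega>))" if "k \<in> {1..t}" for k
    unfolding effect_integral_def left_diff_distrib
    using that by (intro Bochner_Integration.integral_diff int)
  then show ?thesis
    using c[of True] c[of False] by (simp add: sum_subtractf)
qed

text \<open>In period 1, being first treated means being treated. Without defiers the difference of
  the two statuses is almost surely the indicator of C.\<close>

lemma effect_integral_1:
  assumes "1 \<le> T" "integrable M W"
  shows "effect_integral 1 W = (LINT \<omega>:group_event M D [C]|M. W \<omega>)"
  unfolding effect_integral_def set_lebesgue_integral_def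
proof (rule integral_cong_AE)
  have [measurable]: "W \<in> borel_measurable M" using assms by simp
  have [measurable]: "(\<lambda>\<omega>. of_bool (first_treated D 1 z \<omega>) :: real) \<in> borel_measurable M" for z
    using assms by (intro measurable_first_treated) auto
  have [measurable]: "group_event M D [C] \<in> events"
    using assms by (intro group_event_measurable) auto
  show "(\<lambda>\<omega>. (of_bool (first_treated D 1 True \<omega>) - of_bool (first_treated D 1 False \<omega>)) * W \<omega>)
    \<in> borel_measurable M" by measurable
  show "(\<lambda>\<omega>. indicat_real (group_event M D [C]) \<omega> *\<^sub>R W \<omega>) \<in> borel_measurable M" by measurable
  show "AE \<omega> in M. (of_bool (first_treated D 1 True \<omega>) - of_bool (first_treated D 1 False \<omega>)) * W \<omega> =
    indicat_real (group_event M D [C]) \<omega> *\<^sub>R W \<omega>"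
    using AE_no_F1[OF assms(1)] AE_space
    by eventually_elim (auto simp: first_treated_def group_event_def indicator_def)
qed

text \<open>Integrates the pointwise identity \<open>first_treated_diff_eq_groups\<close>, whose
  hypotheses hold almost surely.\<close>

lemma effect_integral_eq:
  assumes k: "k \<in> {2..T}" and W: "integrable M W"
  shows "effect_integral k W =
    (\<Sum>g\<in>Gplus k. LINT \<omega>:group_event M D g|M. W \<omega>) - (\<Sum>g\<in>Gminus k. LINT \<omega>:group_event M D g|M. W \<omega>)"
proof -
  have T1: "1 \<le> T" using k by simp
  note [measurable] = W[THEN borel_measurable_integrable]
  have [measurable]: "(\<lambda>\<omega>. of_bool (first_treated D k z \<omega>) :: real) \<in> borel_measurable M" for z
    using k by (intro measurable_first_treated) auto
  have E: "group_event M D g \<in> events" if "g \<in> Gplus k \<union> Gminus k" for g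
    using that k length_Gplus[of g k] length_Gminus[of g k] by (intro group_event_measurable) auto
  have I: "integrable M (\<lambda>\<omega>. indicat_real (group_event M D g) \<omega> * W \<omega>)" if "g \<in> Gplus k \<union> Gminus k" for g
    using integrable_mult_indicator[OF E[OF that] W] by simp
  have "effect_integral k W = (LINT \<omega>|M. (\<Sum>g\<in>Gplus k. indicat_real (group_event M D g) \<omega> * W \<omega>) -
      (\<Sum>g\<in>Gminus k. indicat_real (group_event M D g) \<omega> * W \<omega>))"
    unfolding effect_integral_def
  proof (rule integral_cong_AE)
    show "(\<lambda>\<omega>. (\<Sum>g\<in>Gplus k. indicat_real (group_event M D g) \<omega> * W \<omega>) -
      (\<Sum>g\<in>Gminus k. indicat_real (group_event M D g) \<omega> * W \<omega>)) \<in> borel_measurable M"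
      using I by (intro borel_measurable_diff borel_measurable_sum borel_measurable_integrable) auto
    show "AE \<omega> in M. (of_bool (first_treated D k True \<omega>) - of_bool (first_treated D k False \<omega>)) * W \<omega> =
      (\<Sum>g\<in>Gplus k. indicat_real (group_event M D g) \<omega> * W \<omega>) -
      (\<Sum>g\<in>Gminus k. indicat_real (group_event M D g) \<omega> * W \<omega>)"
      using AE_no_F1[OF T1] AE_monotone_path AE_space
    proof eventually_elim
      case (elim \<omega>)
      have "of_bool (first_treated D k True \<omega>) - of_bool (first_treated D k False \<omega>) =
        (\<Sum>g\<in>Gplus k. indicator (group_event M D g) \<omega>) -
        (\<Sum>g\<in>Gminus k. indicator (group_event M D g) \<omega> :: real)"
        by (rule first_treated_diff_eq_groups) (use k elim in \<open>simp_all\<close>)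
      then show ?case by (simp add: left_diff_distrib sum_distrib_right)
    qed
  qed measurable
  also have "\<dots> = (\<Sum>g\<in>Gplus k. LINT \<omega>|M. indicat_real (group_event M D g) \<omega> * W \<omega>) -
      (\<Sum>g\<in>Gminus k. LINT \<omega>|M. indicat_real (group_event M D g) \<omega> * W \<omega>)"
    using I by (subst Bochner_Integration.integral_diff)
      (auto intro!: arg_cong2[where f = "(-)"] Bochner_Integration.integral_sum Bochner_Integration.integrable_sum)
  finally show ?thesis by (simp add: set_lebesgue_integral_def)
qed

text \<open>For a null group both sides are 0, whatever the junk value of \<^const>\<open>cexp\<close>.\<close>

lemma set_integral_group_event:
  assumes "length g \<le> T"
  shows "(LINT \<omega>:group_event M D g|M. W \<omega>) = group_prob M D g * cexp M W (group_event M D g)"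
proof (cases "group_prob M D g = 0")
  case True
  then have "group_event M D g \<in> null_sets M"
    using group_event_measurable[OF assms] by (simp add: group_prob_def emeasure_eq_measure null_sets_def)
  then have "AE \<omega> in M. indicat_real (group_event M D g) \<omega> *\<^sub>R W \<omega> = 0"
    using AE_not_in by fastforce
  then have "(LINT \<omega>:group_event M D g|M. W \<omega>) = 0"
    unfolding set_lebesgue_integral_def by (rule integral_eq_zero_AE)
  then show ?thesis using True by simp
qed (simp add: cexp_def group_prob_def)

lemma sum_effect_integral:
  assumes t: "t \<in> {1..T}" and W: "\<And>k. k \<in> {1..t} \<Longrightarrow> integrable M (W k)"
  shows "(\<Sum>k=1..t. effect_integral k (W k)) =
    group_prob M D [C] * cexp M (W 1) (group_event M D [C]) +
    (\<Sum>k=2..t. (\<Sum>g\<in>Gplus k. group_prob M D g * cexp M (W k) (group_event M D g)) -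
      (\<Sum>g\<in>Gminus k. group_prob M D g * cexp M (W k) (group_event M D g)))"
proof -
  have "effect_integral k (W k) =
      (\<Sum>g\<in>Gplus k. group_prob M D g * cexp M (W k) (group_event M D g)) -
      (\<Sum>g\<in>Gminus k. group_prob M D g * cexp M (W k) (group_event M D g))" if "k \<in> {2..t}" for k
  proof -
    have "effect_integral k (W k) =
      (\<Sum>g\<in>Gplus k. LINT \<omega>:group_event M D g|M. W k \<omega>) - (\<Sum>g\<in>Gminus k. LINT \<omega>:group_event M D g|M. W k \<omega>)"
      using that t by (intro effect_integral_eq W) auto
    also have "(\<Sum>g\<in>Gplus k. LINT \<omega>:group_event M D g|M. W k \<omega>) =
        (\<Sum>g\<in>Gplus k. group_prob M D g * cexp M (W k) (group_event M D g))"
      using that t length_Gplus[of _ k] by (intro sum.cong refl set_integral_group_event) auto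
    also have "(\<Sum>g\<in>Gminus k. LINT \<omega>:group_event M D g|M. W k \<omega>) =
        (\<Sum>g\<in>Gminus k. group_prob M D g * cexp M (W k) (group_event M D g))"
      using that t length_Gminus[of _ k] by (intro sum.cong refl set_integral_group_event) auto
    finally show ?thesis .
  qed
  moreover have "effect_integral 1 (W 1) = group_prob M D [C] * cexp M (W 1) (group_event M D [C])"
    using t W[of 1] effect_integral_1[of "W 1"] set_integral_group_event[of "[C]" "W 1"] by auto
  moreover have "{1..t} = insert 1 {2..t}" using t by auto
  ultimately show ?thesis by simp
qed

section \<open>Decomposition of the reduced form and the first stage\<close>

lemma measurable_observed_outcome:
  assumes t: "t \<in> {1..T}"
  shows "observed_outcome Z D Y0z Y1z t \<in> borel_measurable M"
proof -
  have Y0: "(\<lambda>\<omega>. Y0z t (Z \<omega>) \<omega>) \<in> borel_measurable M"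
  proof -
    have [measurable]: "Y0z t z \<in> borel_measurable M" for z
      using Y0z_integrable[OF t] by (rule borel_measurable_integrable)
    have "(\<lambda>\<omega>. Y0z t (Z \<omega>) \<omega>) = (\<lambda>\<omega>. if Z \<omega> then Y0z t True \<omega> else Y0z t False \<omega>)"
      by (auto simp: fun_eq_iff)
    then show ?thesis by simp
  qed
  have Y1: "(\<lambda>\<omega>. Y1z t \<tau> (Z \<omega>) \<omega>) \<in> borel_measurable M" if "\<tau> \<in> {0..t - 1}" for \<tau>
  proof -
    have [measurable]: "Y1z t \<tau> z \<in> borel_measurable M" for z
      using Y1z_integrable[OF t that] by (rule borel_measurable_integrable)
    have "(\<lambda>\<omega>. Y1z t \<tau> (Z \<omega>) \<omega>) = (\<lambda>\<omega>. if Z \<omega> then Y1z t \<tau> True \<omega> else Y1z t \<tau> False \<omega>)"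
      by (auto simp: fun_eq_iff)
    then show ?thesis by simp
  qed
  have D: "(\<lambda>\<omega>. of_bool (first_treated D k (Z \<omega>) \<omega>) :: real) \<in> borel_measurable M" if "k \<in> {1..t}" for k
  proof -
    have [measurable]: "(\<lambda>\<omega>. of_bool (first_treated D k z \<omega>) :: real) \<in> borel_measurable M" for z
      using that t by (intro measurable_first_treated) auto
    have "(\<lambda>\<omega>. of_bool (first_treated D k (Z \<omega>) \<omega>) :: real) =
      (\<lambda>\<omega>. if Z \<omega> then of_bool (first_treated D k True \<omega>) else of_bool (first_treated D k False \<omega>))"
      by (auto simp: fun_eq_iff)
    then show ?thesis by simp
  qed
  show ?thesis
    unfolding observed_outcome_eq[abs_def]
    by (intro borel_measurable_add borel_measurable_sum borel_measurable_times borel_measurable_diff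
        Y0 D Y1) auto
qed

lemma RF_eq:
  assumes t: "t \<in> {1..T}"
  shows "RF M Z D Y0z Y1z t =
    group_prob M D [C] * causal_effect M D Y0 Y1 t (t - 1) [C] +
    (\<Sum>k=2..t. (\<Sum>g\<in>Gplus k. group_prob M D g * causal_effect M D Y0 Y1 t (t - k) g) -
      (\<Sum>g\<in>Gminus k. group_prob M D g * causal_effect M D Y0 Y1 t (t - k) g))"
proof -
  \<comment> \<open>First treatment at \<open>k\<close> means lag \<open>t - k\<close> at
    \<open>t\<close>; for \<open>k\<close> in \<open>{1..t}\<close> this lies in
    \<open>{0..t - 1}\<close>, so the coordinate exists.\<close>
  define w :: "nat \<Rightarrow> latent_vector \<Rightarrow> real" where "w k x = fst (snd x) (t - k) - fst x" for k x
  have wX: "w k (X t \<omega>) = Y1 t (t - k) \<omega> - Y0 t \<omega>" if "k \<in> {1..t}" for k \<omega>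
    unfolding w_def X_Y0 using that by (subst X_Y1) auto
  have int: "integrable M (\<lambda>\<omega>. Y1 t (t - k) \<omega> - Y0 t \<omega>)" if "k \<in> {1..t}" for k
    using that t by (intro Bochner_Integration.integrable_diff integrable_Y1 integrable_Y0) auto
  have "RF M Z D Y0z Y1z t = (\<Sum>k=1..t. effect_integral k (\<lambda>\<omega>. w k (X t \<omega>)))"
    unfolding RF_def
  proof (rule cexp_diff[OF t measurable_latent_Y0])
    show "integrable M (\<lambda>\<omega>. fst (X t \<omega>))" using integrable_Y0[OF t] by (simp add: X_Y0)
    show "w k \<in> borel_measurable (latent_measure t)" if "k \<in> {1..t}" for k
      unfolding w_def using that
      by (intro borel_measurable_diff measurable_latent_Y0 measurable_latent_Y1) auto
    show "integrable M (\<lambda>\<omega>. w k (X t \<omega>))" if "k \<in> {1..t}" for k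
      using int[OF that] that by (simp add: wX)
    \<comment> \<open>One null set must serve all lags and both instrument values, because the
      realised lag and \<open>Z \<omega>\<close> vary with \<open>\<omega>\<close>.\<close>
    have "AE \<omega> in M. \<forall>z. Y0z t z \<omega> = Y0 t \<omega>"
      using exclusion t unfolding exclusion_def by (auto simp: all_bool_eq)
    moreover have "AE \<omega> in M. \<forall>\<tau>\<in>{0..t - 1}. \<forall>z. Y1z t \<tau> z \<omega> = Y1 t \<tau> \<omega>"
      using exclusion t unfolding exclusion_def by (intro AE_finite_allI) (auto simp: all_bool_eq)
    ultimately show "AE \<omega> in M. observed_outcome Z D Y0z Y1z t \<omega> = fst (X t \<omega>) +
        (\<Sum>k=1..t. of_bool (first_treated D k (Z \<omega>) \<omega>) * w k (X t \<omega>))"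
    proof eventually_elim
      case (elim \<omega>)
      have "Y1z t (t - k) (Z \<omega>) \<omega> - Y0z t (Z \<omega>) \<omega> = w k (X t \<omega>)" if "k \<in> {1..t}" for k
      proof -
        have "t - k \<in> {0..t - 1}" using that by auto
        then show ?thesis using elim wX[OF that] by simp
      qed
      then show ?case
        unfolding observed_outcome_eq using elim by (simp add: X_Y0)
    qed
  qed (rule measurable_observed_outcome[OF t])
  also have "\<dots> = (\<Sum>k=1..t. effect_integral k (\<lambda>\<omega>. Y1 t (t - k) \<omega> - Y0 t \<omega>))"
    by (intro sum.cong refl) (simp add: wX)
  also have "\<dots> = group_prob M D [C] * causal_effect M D Y0 Y1 t (t - 1) [C] +
    (\<Sum>k=2..t. (\<Sum>g\<in>Gplus k. group_prob M D g * causal_effect M D Y0 Y1 t (t - k) g) -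
      (\<Sum>g\<in>Gminus k. group_prob M D g * causal_effect M D Y0 Y1 t (t - k) g))"
    unfolding causal_effect_def by (rule sum_effect_integral[OF t int])
  finally show ?thesis .
qed

text \<open>On a monotone path, being treated at \<open>t\<close> is the same as having a first
  treatment period in \<open>{1..t}\<close>. Hence \<open>cexp_diff\<close> applies with
  \<open>u = 0\<close> and \<open>w = 1\<close>.\<close>

lemma FS_eq:
  assumes t: "t \<in> {1..T}"
  shows "FS M Z D t = group_prob M D [C] +
    (\<Sum>k=2..t. (\<Sum>g\<in>Gplus k. group_prob M D g) - (\<Sum>g\<in>Gminus k. group_prob M D g))"
proof -
  \<comment> \<open>On a null group the conditional mean of 1 evaluates to 0, and the factor
    \<open>group_prob M D g\<close> restores the identity.\<close>
  have prob_cexp: "group_prob M D g * cexp M (\<lambda>_. 1) (group_event M D g) = group_prob M D g"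
    if "length g \<le> T" for g
    using set_integral_group_event[OF that, of "\<lambda>_. 1"] group_event_measurable[OF that]
    by (simp add: group_prob_def set_lebesgue_integral_def)
  have "FS M Z D t = (\<Sum>k=1..t. effect_integral k (\<lambda>\<omega>. 1))"
    unfolding FS_def
  proof (rule cexp_diff[OF t, where u = "\<lambda>_. 0" and w = "\<lambda>_ _. 1"])
    have [measurable]: "Measurable.pred M (D t z)" for z using t by (rule pred_D)
    have "observed_treatment Z D t = (\<lambda>\<omega>. if Z \<omega> then D t True \<omega> else D t False \<omega>)"
      by (auto simp: observed_treatment_def fun_eq_iff)
    then have [measurable]: "Measurable.pred M (observed_treatment Z D t)" by simp
    show "(\<lambda>\<omega>. of_bool (observed_treatment Z D t \<omega>) :: real) \<in> borel_measurable M" by measurable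
    show "AE \<omega> in M. of_bool (observed_treatment Z D t \<omega>) =
      0 + (\<Sum>k=1..t. of_bool (first_treated D k (Z \<omega>) \<omega>) * (1 :: real))"
      using AE_monotone_path
    proof eventually_elim
      case (elim \<omega>)
      show ?case
      proof (cases "D t (Z \<omega>) \<omega>")
        case True
        then obtain k where k: "k \<in> {1..t}" "first_treated D k (Z \<omega>) \<omega>"
          using ex_first_treated[of t t D "Z \<omega>" \<omega>] t by auto
        show ?thesis
          using True sum_first_treated[OF k, of "\<lambda>_. 1"] by (simp add: observed_treatment_def)
      next
        case False
        then have "\<not> first_treated D k (Z \<omega>) \<omega>" if "k \<in> {1..t}" for k
          using elim that t by (auto simp: first_treated_def)
        then show ?thesis using False by (simp add: observed_treatment_def)
      qed
    qed
  qed simp_all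
  also have "\<dots> = group_prob M D [C] * cexp M (\<lambda>_. 1) (group_event M D [C]) +
    (\<Sum>k=2..t. (\<Sum>g\<in>Gplus k. group_prob M D g * cexp M (\<lambda>_. 1) (group_event M D g)) -
      (\<Sum>g\<in>Gminus k. group_prob M D g * cexp M (\<lambda>_. 1) (group_event M D g)))"
    by (rule sum_effect_integral[OF t]) simp
  also have "\<dots> = group_prob M D [C] +
    (\<Sum>k=2..t. (\<Sum>g\<in>Gplus k. group_prob M D g) - (\<Sum>g\<in>Gminus k. group_prob M D g))"
    using t length_Gplus length_Gminus
    by (intro arg_cong2[where f = "(+)"] arg_cong2[where f = "(-)"] sum.cong refl prob_cexp) auto
  finally show ?thesis .
qed

section \<open>Signs of the weights\<close>

text \<open>At \<open>t = 1\<close> the sum in \<open>FS_eq\<close> is empty, so this probability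
  equals the nonzero first stage of period 1.\<close>

lemma group_prob_C_pos: "1 \<le> T \<Longrightarrow> 0 < group_prob M D [C]"
  using FS_eq[of 1] FS1_nonzero by (simp add: group_prob_def zero_less_measure_iff)

text \<open>The members of \<open>Gminus k\<close> have length \<open>k \<ge> 2\<close>, so the sign
  test in \<open>RF_weight\<close> never catches \<open>[C]\<close>.\<close>

lemma RF_weight_C: "RF_weight M D t [C] = group_prob M D [C]"
proof -
  have "[C] \<notin> Gminus k" if "k \<in> {2..t}" for k
    using length_Gminus[of "[C]" k] that by auto
  then show ?thesis by (auto simp: RF_weight_def)
qed

lemma FS_decrease_imp_Gminus_pos:
  assumes "k \<in> {2..T}" "FS M Z D k < FS M Z D (k - 1)"
  shows "\<exists>g\<in>Gminus k. 0 < group_prob M D g"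
proof -
  have k: "k \<in> {1..T}" "k - 1 \<in> {1..T}" using assms(1) by auto
  have "{2..k} = insert k {2..k - 1}" "k \<notin> {2..k - 1}" using assms(1) by auto
  then have "FS M Z D k = FS M Z D (k - 1) +
      ((\<Sum>g\<in>Gplus k. group_prob M D g) - (\<Sum>g\<in>Gminus k. group_prob M D g))"
    using FS_eq[of k] FS_eq[of "k - 1"] k by simp
  moreover have "0 \<le> (\<Sum>g\<in>Gplus k. group_prob M D g)"
    by (intro sum_nonneg) (simp add: group_prob_def)
  ultimately have "0 < (\<Sum>g\<in>Gminus k. group_prob M D g)" using assms(2) by linarith
  then have "\<not> (\<forall>g\<in>Gminus k. group_prob M D g \<le> 0)"
    using sum_nonpos[of "Gminus k" "group_prob M D"] by force
  then show ?thesis by (simp add: not_le)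
qed

end

section \<open>An example with a negative weight\<close>

text \<open>Four equally likely points carry two independent fair coins: the parity of
  \<open>\<omega>\<close> is the instrument, and \<open>2 \<le> \<omega>\<close> is the latent
  type.\<close>

definition unif4 :: "nat measure" where
  "unif4 = measure_pmf (pmf_of_set {0, 1, 2, 3})"

interpretation unif4: prob_space unif4
  unfolding unif4_def by (rule measure_pmf.prob_space_axioms)

lemma space_unif4 [simp]: "space unif4 = UNIV" and sets_unif4 [simp]: "sets unif4 = UNIV"
  by (simp_all add: unif4_def)

lemma measure_unif4:
  "measure unif4 A = (of_bool (0 \<in> A) + of_bool (1 \<in> A) + of_bool (2 \<in> A) + of_bool (3 \<in> A)) / 4"
  by (simp add: unif4_def measure_pmf_of_set Int_insert_left)

lemma set_integral_unif4:
  fixes f :: "nat \<Rightarrow> real"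
  shows "(LINT \<omega>:A|unif4. f \<omega>) = (of_bool (0 \<in> A) * f 0 + of_bool (1 \<in> A) * f 1 +
    of_bool (2 \<in> A) * f 2 + of_bool (3 \<in> A) * f 3) / 4"
  by (simp add: unif4_def set_lebesgue_integral_def integral_pmf_of_set indicator_def)

definition ex_Z :: "nat \<Rightarrow> bool" where
  "ex_Z \<omega> \<longleftrightarrow> odd \<omega>"

text \<open>Every unit is a complier in period 1; the units with \<open>\<omega> \<ge> 2\<close>, half of the population, become
  always-takers in period 2.\<close>

definition ex_D :: "nat \<Rightarrow> bool \<Rightarrow> nat \<Rightarrow> bool" where
  "ex_D s z \<omega> \<longleftrightarrow> z \<or> 2 \<le> s \<and> 2 \<le> \<omega>"

text \<open>\<open>X\<close> factors through the coin \<open>2 \<le> \<omega>\<close>, which is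
  independent of parity; the product rule is then a finite computation.\<close>

lemma indep_rv_unif4:
  assumes X: "X \<in> measurable unif4 A" and X': "\<And>\<omega>. X \<omega> = f (2 \<le> \<omega>)"
  shows "indep_rv unif4 A X (count_space UNIV) ex_Z"
  unfolding indep_rv_def
proof (intro conjI X unif4.indep_setI)
  show "ex_Z \<in> measurable unif4 (count_space UNIV)" by (simp add: measurable_def)
  fix a b
  assume "a \<in> {X -` S \<inter> space unif4 |S. S \<in> sets A}"
    and "b \<in> {ex_Z -` S \<inter> space unif4 |S. S \<in> sets (count_space UNIV)}"
  then obtain S S' where "a = X -` S" "b = ex_Z -` S'" by auto
  then show "measure unif4 (a \<inter> b) = measure unif4 a * measure unif4 b"
    by (simp add: measure_unif4 X' ex_Z_def field_simps)
qed auto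

text \<open>With the instrument on, everyone is treated. With it off, nobody is treated before
  period 2, and half of the units are from then on.\<close>

lemma FS_ex: "FS unif4 ex_Z ex_D t = (if 2 \<le> t then 1 / 2 else 1)"
  by (simp add: FS_def cexp_def measure_unif4 set_integral_unif4 ex_Z_def ex_D_def observed_treatment_def)

text \<open>All potential outcomes are 0, since the weights depend only on the instrument and the
  treatment paths.\<close>

lemma iv_assumptions_ex:
  "iv_assumptions unif4 T ex_Z ex_D (\<lambda>_ _ _. 0) (\<lambda>_ _ _ _. 0) (\<lambda>_ _. 0) (\<lambda>_ _ _. 0)"
  unfolding iv_assumptions_def
proof (intro conjI)
  show "iv_setting unif4 T ex_Z ex_D (\<lambda>_ _ _. 0) (\<lambda>_ _ _ _. 0)"
    by unfold_locales (simp_all add: measurable_def measure_unif4 ex_Z_def)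
  show "irreversible_treatment unif4 T ex_Z ex_D"
    by (auto simp: irreversible_treatment_def observed_treatment_def ex_D_def)
  show "exclusion unif4 T (\<lambda>_ _ _. 0) (\<lambda>_ _ _ _. 0) (\<lambda>_ _. 0) (\<lambda>_ _ _. 0)"
    by (simp add: exclusion_def)
  show "independence unif4 T ex_Z ex_D (\<lambda>_ _. 0) (\<lambda>_ _ _. 0)"
    unfolding independence_def
  proof
    fix t
    show "indep_rv unif4
        (borel \<Otimes>\<^sub>M (\<Pi>\<^sub>M \<tau>\<in>{0..t - 1}. borel) \<Otimes>\<^sub>M (\<Pi>\<^sub>M p\<in>{1..t} \<times> UNIV. count_space UNIV))
        (\<lambda>\<omega>. (0, \<lambda>\<tau>\<in>{0..t - 1}. 0, \<lambda>(s, z)\<in>{1..t} \<times> UNIV. ex_D s z \<omega>))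
        (count_space UNIV) ex_Z"
    proof (rule indep_rv_unif4[where f = "\<lambda>b. (0, \<lambda>\<tau>\<in>{0..t - 1}. 0, \<lambda>(s, z)\<in>{1..t} \<times> UNIV. z \<or> 2 \<le> s \<and> b)"])
      show "(\<lambda>\<omega>. (0, \<lambda>\<tau>\<in>{0..t - 1}. 0, \<lambda>(s, z)\<in>{1..t} \<times> UNIV. ex_D s z \<omega>)) \<in> unif4 \<rightarrow>\<^sub>M
        borel \<Otimes>\<^sub>M (\<Pi>\<^sub>M \<tau>\<in>{0..t - 1}. borel) \<Otimes>\<^sub>M (\<Pi>\<^sub>M p\<in>{1..t} \<times> UNIV. count_space UNIV)"
        by (auto simp: measurable_def space_pair_measure space_PiM PiE_def)
    qed (simp add: ex_D_def)
  qed
  show "FS unif4 ex_Z ex_D 1 \<noteq> 0" by (simp add: FS_ex)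
  show "measure unif4 (type_event unif4 ex_D 1 F) = 0"
    by (simp add: measure_unif4 ex_D_def)
qed

text \<open>The witness \<open>[C, AT]\<close> has mass 1/2 and lies in \<open>Gminus 2\<close>,
  while the first stage is 1/2; its weight is -1.\<close>

lemma ratio_weight_ex:
  assumes "2 \<le> t"
  shows "\<exists>g\<in>effect_groups t. ratio_weight unif4 ex_Z ex_D t g < 0"
proof
  have G: "[C, AT] \<in> Gminus 2" by (simp add: Gminus_def numeral_2_eq_2)
  with assms show "[C, AT] \<in> effect_groups t" by (auto simp: effect_groups_def)
  have "group_prob unif4 ex_D [C, AT] = 1 / 2"
    by (simp add: group_prob_def group_event_def measure_unif4 ex_D_def All_less_Suc)
  moreover have "RF_weight unif4 ex_D t [C, AT] = - group_prob unif4 ex_D [C, AT]"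
    using G assms by (auto simp: RF_weight_def)
  ultimately show "ratio_weight unif4 ex_Z ex_D t [C, AT] < 0"
    using assms by (simp add: ratio_weight_def FS_ex)
qed

section \<open>The decomposition and the claims about its weights\<close>

theorem corollary3p1:
  fixes M :: "'a measure"
    and T t :: nat
    and Z :: "'a \<Rightarrow> bool"
    and D :: "nat \<Rightarrow> bool \<Rightarrow> 'a \<Rightarrow> bool"
    and Y0z :: "nat \<Rightarrow> bool \<Rightarrow> 'a \<Rightarrow> real"
    and Y1z :: "nat \<Rightarrow> nat \<Rightarrow> bool \<Rightarrow> 'a \<Rightarrow> real"
    and Y0 :: "nat \<Rightarrow> 'a \<Rightarrow> real"
    and Y1 :: "nat \<Rightarrow> nat \<Rightarrow> 'a \<Rightarrow> real"
  assumes "iv_assumptions M T Z D Y0z Y1z Y0 Y1"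
    and "t \<in> {1..T} - {1}"
    and "FS M Z D t \<noteq> 0"
  shows
    "(RF M Z D Y0z Y1z t / FS M Z D t =
      group_prob M D [C] / FS M Z D t * causal_effect M D Y0 Y1 t (t - 1) [C] +
      (\<Sum>k=2..t. \<Sum>g\<in>Gminus k.
        (- group_prob M D g / FS M Z D t) * causal_effect M D Y0 Y1 t (t - k) g) +
      (\<Sum>k=2..t. \<Sum>g\<in>Gplus k.
        (group_prob M D g / FS M Z D t) * causal_effect M D Y0 Y1 t (t - k) g)) \<and>
    (group_prob M D [C] / FS M Z D t +
      (\<Sum>k=2..t. \<Sum>g\<in>Gminus k. - group_prob M D g / FS M Z D t) +
      (\<Sum>k=2..t. \<Sum>g\<in>Gplus k. group_prob M D g / FS M Z D t) = 1) \<and>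
    (\<exists>(M' :: nat measure) Z' D' Y0z' Y1z' Y0' Y1'.
      iv_assumptions M' T Z' D' Y0z' Y1z' Y0' Y1' \<and> FS M' Z' D' t \<noteq> 0 \<and>
      (\<exists>g\<in>effect_groups t. ratio_weight M' Z' D' t g < 0)) \<and>
    ((\<exists>k\<in>{2..t}. FS M Z D k < FS M Z D (k - 1)) \<longrightarrow>
      (\<exists>g\<in>effect_groups t. ratio_weight M Z D t g < 0)) \<and>
    ({g \<in> effect_groups t. ratio_weight M Z D t g < 0} =
        {g \<in> effect_groups t. RF_weight M D t g < 0} \<longleftrightarrow>
      FS M Z D t > 0)"
proof -
  interpret iv_model M T Z D Y0z Y1z Y0 Y1
    using assms(1) unfolding iv_assumptions_iff_iv_model .
  have t: "t \<in> {1..T}" "2 \<le> t" and T: "1 \<le> T" using assms(2) by auto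
  let ?FS = "FS M Z D t" and ?P = "group_prob M D" and ?\<Delta> = "\<lambda>k. causal_effect M D Y0 Y1 t (t - k)"
  have C_pos: "0 < ?P [C]" using group_prob_C_pos[OF T] .
  have C: "[C] \<in> effect_groups t" by (simp add: effect_groups_def)
  have RF: "RF M Z D Y0z Y1z t / ?FS = ?P [C] / ?FS * ?\<Delta> 1 [C] +
      (\<Sum>k=2..t. \<Sum>g\<in>Gminus k. (- ?P g / ?FS) * ?\<Delta> k g) +
      (\<Sum>k=2..t. \<Sum>g\<in>Gplus k. (?P g / ?FS) * ?\<Delta> k g)"
    unfolding RF_eq[OF t(1)]
    by (simp add: add_divide_distrib diff_divide_distrib sum_divide_distrib sum_subtractf sum_negf)
  have "?P [C] / ?FS + (\<Sum>k=2..t. \<Sum>g\<in>Gminus k. - ?P g / ?FS) + (\<Sum>k=2..t. \<Sum>g\<in>Gplus k. ?P g / ?FS) =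
      (?P [C] + (\<Sum>k=2..t. (\<Sum>g\<in>Gplus k. ?P g) - (\<Sum>g\<in>Gminus k. ?P g))) / ?FS"
    by (simp add: add_divide_distrib diff_divide_distrib sum_divide_distrib sum_subtractf sum_negf)
  also have "\<dots> = ?FS / ?FS"
    unfolding FS_eq[OF t(1), symmetric] ..
  finally have weights: "?P [C] / ?FS + (\<Sum>k=2..t. \<Sum>g\<in>Gminus k. - ?P g / ?FS) +
      (\<Sum>k=2..t. \<Sum>g\<in>Gplus k. ?P g / ?FS) = 1"
    using assms(3) by simp
  have ex: "\<exists>(M' :: nat measure) Z' D' Y0z' Y1z' Y0' Y1'.
      iv_assumptions M' T Z' D' Y0z' Y1z' Y0' Y1' \<and> FS M' Z' D' t \<noteq> 0 \<and>
      (\<exists>g\<in>effect_groups t. ratio_weight M' Z' D' t g < 0)"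
    using iv_assumptions_ex[of T] FS_ex[of t] ratio_weight_ex[OF t(2)]
    by (intro exI[of _ unif4] exI[of _ ex_Z] exI[of _ ex_D] exI[of _ "\<lambda>_ _ _. 0"]
        exI[of _ "\<lambda>_ _ _ _. 0"] exI[of _ "\<lambda>_ _. 0"] conjI) simp_all
  have C_neg: "ratio_weight M Z D t [C] < 0" if "?FS < 0"
    using that C_pos by (simp add: ratio_weight_def RF_weight_C divide_neg_neg divide_pos_neg)
  have neg: "\<exists>g\<in>effect_groups t. ratio_weight M Z D t g < 0"
    if "\<exists>k\<in>{2..t}. FS M Z D k < FS M Z D (k - 1)"
  \<comment> \<open>A negative first stage reverses the signs on \<open>Gminus\<close>, so the
    negative weight is then found at \<open>[C]\<close>; for a positive one it sits on a group of
    positive mass in \<open>Gminus k\<close>.\<close>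
  proof (cases "?FS < 0")
    case True
    then show ?thesis using C C_neg by blast
  next
    case False
    from that obtain k where k: "k \<in> {2..t}" "FS M Z D k < FS M Z D (k - 1)" by blast
    then obtain g where g: "g \<in> Gminus k" "0 < ?P g"
      using FS_decrease_imp_Gminus_pos[of k] t by auto
    have "RF_weight M D t g = - ?P g" using g k by (auto simp: RF_weight_def)
    then have "ratio_weight M Z D t g < 0"
      using g False assms(3) by (simp add: ratio_weight_def)
    moreover have "g \<in> effect_groups t" using g k by (auto simp: effect_groups_def)
    ultimately show ?thesis by blast
  qed
  have "{g \<in> effect_groups t. ratio_weight M Z D t g < 0} =
      {g \<in> effect_groups t. RF_weight M D t g < 0} \<longleftrightarrow> 0 < ?FS"
  proof
    assume eq: "{g \<in> effect_groups t. ratio_weight M Z D t g < 0} =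
      {g \<in> effect_groups t. RF_weight M D t g < 0}"
    \<comment> \<open>\<open>[C]\<close> separates the two sets when the first stage is negative:
      only its ratio weight is then below 0.\<close>
    have "[C] \<notin> {g \<in> effect_groups t. RF_weight M D t g < 0}"
      using C_pos by (simp add: RF_weight_C)
    then have "\<not> ?FS < 0"
      using C C_neg unfolding eq[symmetric] by blast
    then show "0 < ?FS" using assms(3) by simp
  next
    assume "0 < ?FS"
    then show "{g \<in> effect_groups t. ratio_weight M Z D t g < 0} =
      {g \<in> effect_groups t. RF_weight M D t g < 0}"
      by (simp add: ratio_weight_def divide_less_0_iff)
  qed
  then show ?thesis
    using RF weights ex neg by blast
qed

end
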